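(* Let $X$ be a Banach space, $n\ge1$, and let $\mathscr{M}$ be the Rademacher maximal operator associated with a dyadic system $\mathscr{D}$ on $\mathbb{R}^n$. Suppose that for some $1<p<\infty$ there is a constant $C_p$ with $\int_{\mathbb{R}^n}\mathscr{M}f(x)^p\,dx\le C_p\int_{\mathbb{R}^n}\|f(x)\|^p\,dx$ for all $f\in L^p(X)$. Then there is a constant $C$ such that $$\|\mathscr{M}f\|_{\mathrm{BMO}}\le C\,\|f\|_{\mathrm{BMO}(X)}$$ for every $f\in L^1_{\mathrm{loc}}(X)$ with $\mathscr{M}f<\infty$ almost everywhere.
   Context: Dyadic system: $\mathscr{D}=\bigcup_{k\in\mathbb{Z}}\mathscr{D}_k$, where each $\mathscr{D}_k$ is a partition of $\mathbb{R}^n$ into (half-open, axis-parallel) cubes of sidelength $2^{-k}$ and every $Q\in\mathscr{D}_k$ is a union of $2^n$ cubes of $\mathscr{D}_{k+1}$. $|\cdot|$ is Lebesgue measure. R-bound: let $(\varepsilon_k)$ be independent random variables taking values $+1$ and $-1$, each with probability $1/2$, and let $\mathbb{E}$ denote expectation. For $S\subset X$, the R-bound $\mathscr{R}(S)\in[0,\infty]$ is the smallest $C$ such that $\big(\mathbb{E}\|\sum_k\varepsilon_k\lambda_k\xi_k\|^2\big)^{1/2}\le C\big(\sum_k|\lambda_k|^2\big)^{1/2}$ for all finite families of vectors $\xi_k\in S$ and scalars $\lambda_k$ ($\mathscr{R}(S)=\infty$ if no such $C$ exists). Rademacher maximal function: for $f\in L^1_{\mathrm{loc}}(X)$ (locally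 Bochner integrable $f:\mathbb{R}^n\to X$), $\langle f\rangle_Q=\frac{1}{|Q|}\int_Q f(y)\,dy$ and $\mathscr{M}f(x)=\mathscr{R}(\langle f\rangle_Q: Q\in\mathscr{D},\,Q\ni x)$, $x\in\mathbb{R}^n$. $L^p(X)$ is the Lebesgue–Bochner space on $\mathbb{R}^n$. Dyadic BMO: for $f\in L^1_{\mathrm{loc}}(X)$, $\|f\|_{\mathrm{BMO}(X)}=\sup_{Q\in\mathscr{D}}\frac{1}{|Q|}\int_Q\|f(x)-\langle f\rangle_Q\|\,dx\in[0,\infty]$ (by the John–Nirenberg inequality, replacing the inner average by $\big(\frac{1}{|Q|}\int_Q\|f-\langle f\rangle_Q\|^r\,dx\big)^{1/r}$ for any $1\le r<\infty$ gives a comparable quantity). For scalar functions $g$, the BMO norm is, up to constants, $\|g\|_{\mathrm{BMO}}=\sup_{Q\in\mathscr{D}}\inf_{c_Q}\frac{1}{|Q|}\int_Q|g(x)-c_Q|\,dx$, the infimum being over scalars $c_Q$. *)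

theory Defs
  imports "HOL-Probability.Probability"
begin

text \<open>
  Scalars. A real normed field is (isometrically) either the field of real or the field of
  complex numbers, so a Banach space over \<open>'k\<close> with \<open>'k :: real_normed_field\<close> covers exactly
  the real and the complex Banach spaces. The type class \<^class>\<open>banach\<close> provides the underlying
  real Banach space; \<open>sc\<close> is the scalar multiplication by elements of \<open>'k\<close>.
\<close>

definition banach_scaling :: "('k::real_normed_field \<Rightarrow> 'a::banach \<Rightarrow> 'a) \<Rightarrow> bool" where
  "banach_scaling sc \<longleftrightarrow>
     vector_space sc \<and>
     (\<forall>r x. sc (of_real r) x = r *\<^sub>R x) \<and>
     (\<forall>c x. norm (sc c x) = norm c * norm x)"

lemma banach_scaling_scaleR: "banach_scaling (scaleR :: real \<Rightarrow> 'a::banach \<Rightarrow> 'a)"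
  unfolding banach_scaling_def
  by (auto intro!: real_vector.vector_space_axioms)

lemma banach_scaling_complex: "banach_scaling ((*) :: complex \<Rightarrow> complex \<Rightarrow> complex)"
  unfolding banach_scaling_def
  by (auto simp: vector_space_def algebra_simps norm_mult scaleR_conv_of_real)


text \<open>
  Bochner integration. The library integral needs a separable range space (sort
  \<^class>\<open>second_countable_topology\<close>), which is not assumed here. The following is
  \<^const>\<open>has_bochner_integral\<close> without that restriction; the convergence of the simple functions
  forces \<open>f\<close> to be essentially separably valued.
\<close>

definition has_bochner :: "'b measure \<Rightarrow> ('b \<Rightarrow> 'a::banach) \<Rightarrow> 'a \<Rightarrow> bool" where
  "has_bochner M f I \<longleftrightarrow>
     f \<in> borel_measurable M \<and>
     (\<exists>s. (\<forall>i. Bochner_Integration.simple_bochner_integrable M (s i)) \<and>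
          (\<lambda>i. \<integral>\<^sup>+x. ennreal (norm (f x - s i x)) \<partial>M) \<longlonglongrightarrow> 0 \<and>
          (\<lambda>i. Bochner_Integration.simple_bochner_integral M (s i)) \<longlonglongrightarrow> I)"

lemma has_bochner_iff_has_bochner_integral:
  fixes f :: "'b \<Rightarrow> 'a::{banach, second_countable_topology}"
  shows "has_bochner M f I \<longleftrightarrow> has_bochner_integral M f I"
  unfolding has_bochner_def has_bochner_integral.simps by blast

definition bochner_integrable :: "'b measure \<Rightarrow> ('b \<Rightarrow> 'a::banach) \<Rightarrow> bool" where
  "bochner_integrable M f \<longleftrightarrow> (\<exists>I. has_bochner M f I)"

definition bochner_int :: "'b measure \<Rightarrow> ('b \<Rightarrow> 'a::banach) \<Rightarrow> 'a" where
  "bochner_int M f = (THE I. has_bochner M f I)"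

definition strongly_measurable :: "'b measure \<Rightarrow> ('b \<Rightarrow> 'a::banach) \<Rightarrow> bool" where
  "strongly_measurable M f \<longleftrightarrow>
     (\<exists>s. (\<forall>i::nat. simple_function M (s i)) \<and> (AE x in M. (\<lambda>i. s i x) \<longlonglongrightarrow> f x))"

definition locally_bochner_integrable :: "(real^'n \<Rightarrow> 'a::banach) \<Rightarrow> bool" where
  "locally_bochner_integrable f \<longleftrightarrow>
     (\<forall>K. compact K \<longrightarrow> bochner_integrable lebesgue (\<lambda>x. indicator K x *\<^sub>R f x))"

definition in_Lp :: "real \<Rightarrow> (real^'n \<Rightarrow> 'a::banach) \<Rightarrow> bool" where
  "in_Lp p f \<longleftrightarrow>
     strongly_measurable lebesgue f \<and> (\<integral>\<^sup>+x. ennreal (norm (f x) powr p) \<partial>lebesgue) < \<infinity>"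

definition average :: "(real^'n \<Rightarrow> 'a::banach) \<Rightarrow> (real^'n) set \<Rightarrow> 'a" where
  "average f Q =
     (1 / measure lebesgue Q) *\<^sub>R bochner_int lebesgue (\<lambda>x. indicator Q x *\<^sub>R f x)"


definition half_open_cube :: "real^'n \<Rightarrow> real \<Rightarrow> (real^'n) set" where
  "half_open_cube a l = {x. \<forall>i. a $ i \<le> x $ i \<and> x $ i < a $ i + l}"

definition dyadic_system :: "(int \<Rightarrow> (real^'n) set set) \<Rightarrow> bool" where
  "dyadic_system D \<longleftrightarrow>
     (\<forall>k. partition_on UNIV (D k) \<and>
          (\<forall>Q\<in>D k. \<exists>a. Q = half_open_cube a (2 powi (- k))) \<and>
          (\<forall>Q\<in>D k. \<exists>F. F \<subseteq> D (k + 1) \<and> card F = 2 ^ CARD('n) \<and> Q = \<Union>F))"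


definition rademacher_pmf :: "nat \<Rightarrow> (nat \<Rightarrow> real) pmf" where
  "rademacher_pmf N = Pi_pmf {..<N} 0 (\<lambda>_. pmf_of_set {1, -1})"

text \<open>
  A finite family is indexed by \<open>{..<N}\<close> and may repeat vectors. The infimum over the empty set
  of constants is \<open>\<infinity>\<close>.
\<close>

definition Rbound :: "('k::real_normed_field \<Rightarrow> 'a::banach \<Rightarrow> 'a) \<Rightarrow> 'a set \<Rightarrow> ennreal" where
  "Rbound sc S = Inf {ennreal C | C. C \<ge> 0 \<and>
     (\<forall>(N::nat) \<xi> c. (\<forall>k<N. \<xi> k \<in> S) \<longrightarrow>
        sqrt (measure_pmf.expectation (rademacher_pmf N)
                (\<lambda>\<epsilon>. (norm (\<Sum>k<N. \<epsilon> k *\<^sub>R sc (c k) (\<xi> k)))\<^sup>2))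
        \<le> C * sqrt (\<Sum>k<N. (norm (c k))\<^sup>2))}"

definition rademacher_maximal ::
  "('k::real_normed_field \<Rightarrow> 'a::banach \<Rightarrow> 'a) \<Rightarrow> (int \<Rightarrow> (real^'n) set set) \<Rightarrow>
   (real^'n \<Rightarrow> 'a) \<Rightarrow> real^'n \<Rightarrow> ennreal" where
  "rademacher_maximal sc D f x = Rbound sc {average f Q | Q. Q \<in> (\<Union>k. D k) \<and> x \<in> Q}"


definition ennreal_powr :: "ennreal \<Rightarrow> real \<Rightarrow> ennreal" where
  "ennreal_powr x p = (if x = \<infinity> then \<infinity> else ennreal (enn2real x powr p))"

definition bmo_norm :: "(int \<Rightarrow> (real^'n) set set) \<Rightarrow> (real^'n \<Rightarrow> 'a::banach) \<Rightarrow> ennreal" where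
  "bmo_norm D f = (SUP Q\<in>(\<Union>k. D k).
     (\<integral>\<^sup>+x\<in>Q. ennreal (norm (f x - average f Q)) \<partial>lebesgue) / emeasure lebesgue Q)"

text \<open>
  The scalar seminorm is stated for functions with values in the extended reals, since a maximal
  function may be infinite on a null set. The constants range over finite reals.
\<close>

definition scalar_bmo_norm :: "(int \<Rightarrow> (real^'n) set set) \<Rightarrow> (real^'n \<Rightarrow> ereal) \<Rightarrow> ennreal" where
  "scalar_bmo_norm D g = (SUP Q\<in>(\<Union>k. D k). INF c::real.
     (\<integral>\<^sup>+x\<in>Q. e2ennreal \<bar>g x - ereal c\<bar> \<partial>lebesgue) / emeasure lebesgue Q)"

end

theory Submission
  imports Defs "HOL-Real_Asymp.Real_Asymp"
begin

text \<open>
  Fix a dyadic cube \<open>Q\<close> and split off \<open>h = 1\<^sub>Q (f - v)\<close>, where \<open>v\<close> is the average of \<open>f\<close> over \<open>Q\<close>. At every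
  point of \<open>Q\<close>, a cube containing that point either contains \<open>Q\<close> or is contained in \<open>Q\<close>, and in the latter
  case its average of \<open>f\<close> is \<open>v\<close> plus its average of \<open>h\<close>. As R-bounds are subadditive under Minkowski
  sums, the maximal function of \<open>f\<close> differs on \<open>Q\<close> from the constant \<open>c\<close>, the R-bound of the averages
  over the cubes containing \<open>Q\<close>, by at most the maximal function of \<open>h\<close>; \<open>c\<close> is finite since the maximal function is
  finite somewhere on \<open>Q\<close>. The mean of the maximal function of \<open>h\<close> over \<open>Q\<close> is controlled by the assumed \<open>L\<^sup>p\<close> bound, and
  the John--Nirenberg inequality bounds the \<open>L\<^sup>p\<close> norm of \<open>h\<close> by the BMO norm of \<open>f\<close>.
\<close>

subsection \<open>Bochner integration without separability\<close>

lemma borel_measurable_norm_nonseparable: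
  fixes f :: "'b \<Rightarrow> 'a::real_normed_vector"
  assumes f: "f \<in> borel_measurable M"
  shows "(\<lambda>x. norm (f x)) \<in> borel_measurable M"
  by (rule measurable_compose[OF f]) (intro borel_measurable_continuous_onI continuous_intros)

text \<open>With a non-separable range, the difference of two Borel functions need not be Borel.
  Here \<open>s\<close> has finitely many values, so the difference is glued from finitely many
  translates of \<open>f\<close>.\<close>

lemma borel_measurable_diff_simple:
  fixes f :: "'b \<Rightarrow> 'a::banach"
  assumes f: "f \<in> borel_measurable M" and s: "simple_function M s"
  shows "(\<lambda>x. f x - s x) \<in> borel_measurable M"
proof (rule measurable_compose_countable'[where I = "s ` space M" and g = s and f = "\<lambda>i x. f x - i"])
  show "(\<lambda>x. f x - i) \<in> borel_measurable M" for i
    by (rule measurable_compose[OF f]) (intro borel_measurable_continuous_onI continuous_intros)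
  show "s \<in> measurable M (count_space (s ` space M))"
    using measurable_simple_function[OF s] by (auto simp: measurable_def)
  show "countable (s ` space M)"
    using simple_functionD(1)[OF s] by (rule countable_finite)
qed

lemma borel_measurable_norm_diff_simple:
  fixes f :: "'b \<Rightarrow> 'a::banach"
  assumes f: "f \<in> borel_measurable M" and s: "simple_function M s"
  shows "(\<lambda>x. ennreal (norm (f x - s x))) \<in> borel_measurable M"
  using borel_measurable_diff_simple[OF assms]
  by (intro measurable_compose[OF _ measurable_ennreal] borel_measurable_norm_nonseparable)

lemma simple_bochner_integrable_indicator_scaleR:
  assumes "Bochner_Integration.simple_bochner_integrable M s" "A \<in> sets M"
  shows "Bochner_Integration.simple_bochner_integrable M (\<lambda>x. indicator A x *\<^sub>R s x)"
proof
  show "simple_function M (\<lambda>x. indicator A x *\<^sub>R s x)"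
    using assms by (intro simple_function_compose2[where h = scaleR])
      (auto elim: simple_bochner_integrable.cases)
  have "emeasure M {y \<in> space M. indicator A y *\<^sub>R s y \<noteq> 0} \<le> emeasure M {y \<in> space M. s y \<noteq> 0}"
    using assms by (intro emeasure_mono)
      (auto elim!: simple_bochner_integrable.cases intro!: simple_functionD(2))
  with assms show "emeasure M {y \<in> space M. indicator A y *\<^sub>R s y \<noteq> 0} \<noteq> \<infinity>"
    by (auto elim!: simple_bochner_integrable.cases simp: top_unique)
qed

lemma norm_simple_bochner_integral_diff_le:
  assumes "Bochner_Integration.simple_bochner_integrable M s"
    and "Bochner_Integration.simple_bochner_integrable M t"
  shows "ennreal (norm (Bochner_Integration.simple_bochner_integral M s
      - Bochner_Integration.simple_bochner_integral M t)) \<le> (\<integral>\<^sup>+x. ennreal (norm (s x - t x)) \<partial>M)"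
proof -
  have "norm (Bochner_Integration.simple_bochner_integral M s
      - Bochner_Integration.simple_bochner_integral M t)
    = norm (Bochner_Integration.simple_bochner_integral M (\<lambda>x. s x - t x))"
    using assms by (subst simple_bochner_integral_diff) auto
  also have "\<dots> \<le> Bochner_Integration.simple_bochner_integral M (\<lambda>x. norm (s x - t x))"
    using simple_bochner_integrable_compose2[of "(-)" M s t] assms
    by (auto intro!: simple_bochner_integral_norm_bound)
  finally have "ennreal (norm (Bochner_Integration.simple_bochner_integral M s
      - Bochner_Integration.simple_bochner_integral M t))
    \<le> ennreal (Bochner_Integration.simple_bochner_integral M (\<lambda>x. norm (s x - t x)))"
    by (rule ennreal_leI)
  also have "\<dots> = (\<integral>\<^sup>+x. norm (s x - t x) \<partial>M)"
    using simple_bochner_integrable_compose2[of "\<lambda>x y. norm (x - y)" M s t] assms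
    by (auto intro!: simple_bochner_integral_eq_nn_integral)
  finally show ?thesis .
qed

text \<open>The triangle inequality along the chain \<open>s\<close>, \<open>f\<close>,
  \<open>g\<close>, \<open>t\<close>. Measurability of the middle term is assumed because it does
  not follow from that of \<open>f\<close> and \<open>g\<close> separately.\<close>

lemma nn_integral_norm_diff_simple_le:
  fixes f g :: "'b \<Rightarrow> 'a::banach"
  assumes f: "f \<in> borel_measurable M" and g: "g \<in> borel_measurable M"
    and s: "Bochner_Integration.simple_bochner_integrable M s"
    and t: "Bochner_Integration.simple_bochner_integrable M t"
    and fg: "(\<lambda>x. ennreal (norm (f x - g x))) \<in> borel_measurable M"
  shows "(\<integral>\<^sup>+x. ennreal (norm (s x - t x)) \<partial>M) \<le>
    (\<integral>\<^sup>+x. ennreal (norm (f x - s x)) \<partial>M) + (\<integral>\<^sup>+x. ennreal (norm (f x - g x)) \<partial>M)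
      + (\<integral>\<^sup>+x. ennreal (norm (g x - t x)) \<partial>M)"
proof -
  have st: "simple_function M s" "simple_function M t"
    using s t by (auto elim: simple_bochner_integrable.cases)
  note m = borel_measurable_norm_diff_simple[OF f st(1)]
    borel_measurable_norm_diff_simple[OF g st(2)] fg
  have "norm (s x - t x) \<le> norm (f x - s x) + norm (f x - g x) + norm (g x - t x)" for x
    using norm_triangle_ineq4[of "f x - t x" "f x - s x"] norm_triangle_ineq[of "f x - g x" "g x - t x"]
    by simp
  then have "(\<integral>\<^sup>+x. ennreal (norm (s x - t x)) \<partial>M) \<le>
    (\<integral>\<^sup>+x. ennreal (norm (f x - s x)) + ennreal (norm (f x - g x)) + ennreal (norm (g x - t x)) \<partial>M)"
    by (intro nn_integral_mono) (auto simp flip: ennreal_plus)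
  also have "\<dots> = (\<integral>\<^sup>+x. ennreal (norm (f x - s x)) \<partial>M) + (\<integral>\<^sup>+x. ennreal (norm (f x - g x)) \<partial>M)
      + (\<integral>\<^sup>+x. ennreal (norm (g x - t x)) \<partial>M)"
    using m by (simp only: nn_integral_add borel_measurable_add)
  finally show ?thesis .
qed

text \<open>Limit of the corresponding inequality for the simple approximants. The choice
  \<open>g = f\<close> yields uniqueness of the integral, the choice \<open>g = 0\<close> the norm
  bound.\<close>

lemma has_bochner_norm_diff_le:
  fixes f g :: "'b \<Rightarrow> 'a::banach"
  assumes f: "has_bochner M f I" and g: "has_bochner M g J"
    and fg: "(\<lambda>x. ennreal (norm (f x - g x))) \<in> borel_measurable M"
  shows "ennreal (norm (I - J)) \<le> (\<integral>\<^sup>+x. ennreal (norm (f x - g x)) \<partial>M)"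
proof -
  from f obtain s where s: "f \<in> borel_measurable M"
    "\<And>i. Bochner_Integration.simple_bochner_integrable M (s i)"
    "(\<lambda>i. \<integral>\<^sup>+x. ennreal (norm (f x - s i x)) \<partial>M) \<longlonglongrightarrow> 0"
    "(\<lambda>i. Bochner_Integration.simple_bochner_integral M (s i)) \<longlonglongrightarrow> I"
    by (auto simp: has_bochner_def)
  from g obtain t where t: "g \<in> borel_measurable M"
    "\<And>i. Bochner_Integration.simple_bochner_integrable M (t i)"
    "(\<lambda>i. \<integral>\<^sup>+x. ennreal (norm (g x - t i x)) \<partial>M) \<longlonglongrightarrow> 0"
    "(\<lambda>i. Bochner_Integration.simple_bochner_integral M (t i)) \<longlonglongrightarrow> J"
    by (auto simp: has_bochner_def)
  have le: "ennreal (norm (Bochner_Integration.simple_bochner_integral M (s i)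
      - Bochner_Integration.simple_bochner_integral M (t i))) \<le>
    (\<integral>\<^sup>+x. ennreal (norm (f x - s i x)) \<partial>M) + (\<integral>\<^sup>+x. ennreal (norm (f x - g x)) \<partial>M)
      + (\<integral>\<^sup>+x. ennreal (norm (g x - t i x)) \<partial>M)" for i
    using norm_simple_bochner_integral_diff_le[OF s(2) t(2)]
      nn_integral_norm_diff_simple_le[OF s(1) t(1) s(2) t(2) fg] by (rule order_trans)
  have lim: "(\<lambda>i. (\<integral>\<^sup>+x. ennreal (norm (f x - s i x)) \<partial>M) + (\<integral>\<^sup>+x. ennreal (norm (f x - g x)) \<partial>M)
      + (\<integral>\<^sup>+x. ennreal (norm (g x - t i x)) \<partial>M)) \<longlonglongrightarrow> 0 + (\<integral>\<^sup>+x. ennreal (norm (f x - g x)) \<partial>M) + 0"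
    by (intro tendsto_add s t tendsto_const)
  have "(\<lambda>i. ennreal (norm (Bochner_Integration.simple_bochner_integral M (s i)
      - Bochner_Integration.simple_bochner_integral M (t i)))) \<longlonglongrightarrow> ennreal (norm (I - J))"
    by (intro tendsto_ennrealI tendsto_norm tendsto_diff s t)
  from LIMSEQ_le[OF this lim] le show ?thesis by auto
qed

lemma has_bochner_unique:
  fixes f :: "'b \<Rightarrow> 'a::banach"
  assumes "has_bochner M f I" "has_bochner M f J"
  shows "I = J"
  using has_bochner_norm_diff_le[OF assms] by simp

lemma bochner_int_eq:
  fixes f :: "'b \<Rightarrow> 'a::banach"
  assumes "has_bochner M f I"
  shows "bochner_int M f = I"
  unfolding bochner_int_def using assms has_bochner_unique by blast

lemma has_bochner_bochner_int:
  fixes f :: "'b \<Rightarrow> 'a::banach"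
  assumes "bochner_integrable M f"
  shows "has_bochner M f (bochner_int M f)"
  using assms bochner_int_eq by (fastforce simp: bochner_integrable_def)

lemma has_bochner_zero: "has_bochner M (\<lambda>x. 0 :: 'a::banach) 0"
  unfolding has_bochner_def
  by (auto intro!: exI[of _ "\<lambda>_ _. 0"] simp: simple_bochner_integrable.simps simple_bochner_integral_def
      image_constant_conv zero_ennreal_def[symmetric])

lemma has_bochner_norm_le:
  fixes f :: "'b \<Rightarrow> 'a::banach"
  assumes f: "has_bochner M f I"
  shows "ennreal (norm I) \<le> (\<integral>\<^sup>+x. ennreal (norm (f x)) \<partial>M)"
proof -
  have "(\<lambda>x. ennreal (norm (f x))) \<in> borel_measurable M"
    using f by (intro measurable_compose[OF _ measurable_ennreal] borel_measurable_norm_nonseparable)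
      (auto simp: has_bochner_def)
  with has_bochner_norm_diff_le[OF f has_bochner_zero] show ?thesis by simp
qed

lemma borel_measurable_indicator_scaleR:
  fixes f :: "'b \<Rightarrow> 'a::banach"
  assumes f: "f \<in> borel_measurable M" and A: "A \<in> sets M"
  shows "(\<lambda>x. indicator A x *\<^sub>R f x) \<in> borel_measurable M"
proof -
  have "(\<lambda>x. if x \<in> A then f x else 0) \<in> borel_measurable M"
    using f A by (intro measurable_If_set) auto
  also have "(\<lambda>x. if x \<in> A then f x else 0) = (\<lambda>x. indicator A x *\<^sub>R f x)"
    by auto
  finally show ?thesis .
qed

text \<open>Approximants truncated to \<open>A\<close> converge in L^1 to the truncated function;
  their integrals form a Cauchy sequence, and completeness of the range supplies the value.\<close>

lemma bochner_integrable_indicator: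
  fixes f :: "'b \<Rightarrow> 'a::banach"
  assumes f: "bochner_integrable M f" and A: "A \<in> sets M"
  shows "bochner_integrable M (\<lambda>x. indicator A x *\<^sub>R f x)"
proof -
  from f obtain s where s: "f \<in> borel_measurable M"
    "\<And>i. Bochner_Integration.simple_bochner_integrable M (s i)"
    "(\<lambda>i. \<integral>\<^sup>+x. ennreal (norm (f x - s i x)) \<partial>M) \<longlonglongrightarrow> 0"
    by (auto simp: has_bochner_def bochner_integrable_def)
  define t where "t i x = indicator A x *\<^sub>R s i x" for i x
  define g where "g x = indicator A x *\<^sub>R f x" for x
  have t: "Bochner_Integration.simple_bochner_integrable M (t i)" for i
    unfolding t_def using s(2) A by (rule simple_bochner_integrable_indicator_scaleR)
  have g: "g \<in> borel_measurable M"
    unfolding g_def using s(1) A by (rule borel_measurable_indicator_scaleR)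
  have le: "(\<integral>\<^sup>+x. ennreal (norm (g x - t i x)) \<partial>M) \<le> (\<integral>\<^sup>+x. ennreal (norm (f x - s i x)) \<partial>M)" for i
    by (intro nn_integral_mono) (auto simp: t_def g_def indicator_def)
  have lim: "(\<lambda>i. \<integral>\<^sup>+x. ennreal (norm (g x - t i x)) \<partial>M) \<longlonglongrightarrow> 0"
    by (rule tendsto_sandwich[OF _ _ tendsto_const s(3)]) (auto simp: le)
  let ?I = "\<lambda>i. Bochner_Integration.simple_bochner_integral M (t i)"
  have "Cauchy ?I"
  proof (rule metric_CauchyI)
    fix e :: real assume e: "0 < e"
    have "\<forall>\<^sub>F i in sequentially. (\<integral>\<^sup>+x. ennreal (norm (g x - t i x)) \<partial>M) < ennreal (e / 2)"
      using lim by (rule order_tendstoD) (use e in auto)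
    then obtain N where N: "\<And>i. i \<ge> N \<Longrightarrow> (\<integral>\<^sup>+x. ennreal (norm (g x - t i x)) \<partial>M) < ennreal (e / 2)"
      by (auto simp: eventually_sequentially)
    show "\<exists>N. \<forall>m\<ge>N. \<forall>n\<ge>N. dist (?I m) (?I n) < e"
    proof (intro exI allI impI)
      fix m n assume "N \<le> m" "N \<le> n"
      have "ennreal (norm (?I m - ?I n)) \<le> (\<integral>\<^sup>+x. ennreal (norm (t m x - t n x)) \<partial>M)"
        by (rule norm_simple_bochner_integral_diff_le[OF t t])
      \<comment> \<open>Both approximants are compared with the same \<open>g\<close>, so the middle
        term of the chain is zero.\<close>
      also have "\<dots> \<le> (\<integral>\<^sup>+x. ennreal (norm (g x - t m x)) \<partial>M) + (\<integral>\<^sup>+x. ennreal (norm (g x - t n x)) \<partial>M)"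
        using nn_integral_norm_diff_simple_le[OF g g t t, of m n] by simp
      also have "\<dots> < ennreal (e / 2) + ennreal (e / 2)"
        using N[OF \<open>N \<le> m\<close>] N[OF \<open>N \<le> n\<close>] by (rule add_strict_mono)
      also have "\<dots> = ennreal e"
        using e by (simp flip: ennreal_plus)
      finally show "dist (?I m) (?I n) < e"
        using e by (simp add: dist_norm ennreal_less_iff)
    qed
  qed
  then obtain I where "?I \<longlonglongrightarrow> I"
    using Cauchy_convergent convergent_def by blast
  then show ?thesis
    using g t lim unfolding bochner_integrable_def has_bochner_def g_def by blast
qed

text \<open>On a set of finite measure the constant \<open>v\<close> is itself a simple integrable
  function; subtracting it from every approximant leaves the L^1 errors unchanged.\<close>

lemma has_bochner_indicator_diff_const:
  fixes f :: "'b \<Rightarrow> 'a::banach"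
  assumes f: "has_bochner M (\<lambda>x. indicator A x *\<^sub>R f x) I"
    and A: "A \<in> sets M" "emeasure M A < \<infinity>"
  shows "has_bochner M (\<lambda>x. indicator A x *\<^sub>R (f x - v)) (I - measure M A *\<^sub>R v)"
proof -
  define g where "g x = indicator A x *\<^sub>R f x" for x
  have "has_bochner M g I"
    using f by (simp add: g_def[abs_def])
  then obtain s where s: "g \<in> borel_measurable M"
    "\<And>i. Bochner_Integration.simple_bochner_integrable M (s i)"
    "(\<lambda>i. \<integral>\<^sup>+x. ennreal (norm (g x - s i x)) \<partial>M) \<longlonglongrightarrow> 0"
    "(\<lambda>i. Bochner_Integration.simple_bochner_integral M (s i)) \<longlonglongrightarrow> I"
    by (auto simp: has_bochner_def)
  define k where "k x = (indicator A x :: real) *\<^sub>R v" for x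
  have "{y \<in> space M. (indicator A y :: real) \<noteq> 0} = A"
    using sets.sets_into_space[OF A(1)] by (auto simp: indicator_def)
  with A have i: "Bochner_Integration.simple_bochner_integrable M (indicator A :: 'b \<Rightarrow> real)"
    by (intro simple_bochner_integrable.intros) auto
  then have k: "Bochner_Integration.simple_bochner_integrable M k"
    unfolding k_def using simple_bochner_integrable_compose2[OF _ i i, where p = "\<lambda>a _. a *\<^sub>R v"] by simp
  have "Bochner_Integration.simple_bochner_integral M (indicator A :: 'b \<Rightarrow> real) = measure M A"
    using simple_bochner_integral_eq_nn_integral[OF i] A
    by (simp add: ennreal_indicator emeasure_eq_ennreal_measure)
  then have kint: "Bochner_Integration.simple_bochner_integral M k = measure M A *\<^sub>R v"
    unfolding k_def
    by (subst simple_bochner_integral_linear[where f = "\<lambda>a. a *\<^sub>R v"])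
      (auto intro: i bounded_linear.linear bounded_linear_scaleR_left)
  have eq: "(\<lambda>x. indicator A x *\<^sub>R (f x - v)) = (\<lambda>x. g x - k x)"
    by (auto simp: g_def k_def algebra_simps)
  show ?thesis
    unfolding eq has_bochner_def
  proof (intro conjI exI[of _ "\<lambda>i x. s i x - k x"] allI)
    show "(\<lambda>x. g x - k x) \<in> borel_measurable M"
      using s(1) k by (intro borel_measurable_diff_simple) (auto elim: simple_bochner_integrable.cases)
    show "Bochner_Integration.simple_bochner_integrable M (\<lambda>x. s i x - k x)" for i
      using simple_bochner_integrable_compose2[OF _ s(2) k, where p = "(-)"] by simp
    show "(\<lambda>i. \<integral>\<^sup>+x. ennreal (norm (g x - k x - (s i x - k x))) \<partial>M) \<longlonglongrightarrow> 0"
      using s(3) by simp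
    show "(\<lambda>i. Bochner_Integration.simple_bochner_integral M (\<lambda>x. s i x - k x)) \<longlonglongrightarrow> I - measure M A *\<^sub>R v"
      using s(2) k by (subst simple_bochner_integral_diff) (auto simp: kint intro: tendsto_intros s(4))
  qed
qed

text \<open>Convergence of the approximants in L^1 gives almost everywhere convergence along a
  subsequence. This provides the measurability half of \<open>in_Lp\<close> for the localized
  function.\<close>

lemma has_bochner_imp_strongly_measurable:
  fixes f :: "'b \<Rightarrow> 'a::banach"
  assumes "has_bochner M f I"
  shows "strongly_measurable M f"
proof -
  from assms obtain s where s: "f \<in> borel_measurable M"
    "\<And>i. Bochner_Integration.simple_bochner_integrable M (s i)"
    "(\<lambda>i. \<integral>\<^sup>+x. ennreal (norm (f x - s i x)) \<partial>M) \<longlonglongrightarrow> 0"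
    by (auto simp: has_bochner_def)
  have sf: "simple_function M (s i)" for i
    using s(2)[of i] by (auto elim: simple_bochner_integrable.cases)
  have "\<forall>\<^sub>F i in sequentially. (\<integral>\<^sup>+x. ennreal (norm (f x - s i x)) \<partial>M) < 1"
    using s(3) by (rule order_tendstoD) simp
  then obtain N where N: "\<And>i. i \<ge> N \<Longrightarrow> (\<integral>\<^sup>+x. ennreal (norm (f x - s i x)) \<partial>M) < 1"
    by (auto simp: eventually_sequentially)
  \<comment> \<open>From index \<open>N\<close> on the errors have integral below 1. The shift makes
    every \<open>u i\<close> integrable, as the extraction of the subsequence requires.\<close>
  define u where "u i x = norm (f x - s (i + N) x)" for i x
  have m: "u i \<in> borel_measurable M" for i
    unfolding u_def using borel_measurable_diff_simple[OF s(1) sf] by (rule borel_measurable_norm_nonseparable)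
  have u: "integrable M (u i)" for i
    using N[of "i + N"] m[of i] by (intro integrableI_bounded) (auto simp: u_def less_top[symmetric] dest: less_trans)
  have "(\<lambda>i. \<integral>\<^sup>+x. ennreal (u i x) \<partial>M) \<longlonglongrightarrow> 0"
    unfolding u_def using s(3) by (rule LIMSEQ_ignore_initial_segment)
  moreover have "(\<integral>\<^sup>+x. ennreal (u i x) \<partial>M) = ennreal (\<integral>x. norm (u i x) \<partial>M)" for i
    using nn_integral_eq_integral[OF u[of i]] by (simp add: u_def[abs_def])
  ultimately have "(\<lambda>i. ennreal (\<integral>x. norm (u i x) \<partial>M)) \<longlonglongrightarrow> ennreal 0"
    by simp
  then have "(\<lambda>i. \<integral>x. norm (u i x) \<partial>M) \<longlonglongrightarrow> 0"
    by (rule tendsto_ennrealD) auto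
  from tendsto_L1_AE_subseq[OF u this] obtain r :: "nat \<Rightarrow> nat" where
    "AE x in M. (\<lambda>n. u (r n) x) \<longlonglongrightarrow> 0" by auto
  then have "AE x in M. (\<lambda>n. s (r n + N) x) \<longlonglongrightarrow> f x"
  proof eventually_elim
    case (elim x)
    then have "(\<lambda>n. norm (s (r n + N) x - f x)) \<longlonglongrightarrow> 0"
      by (simp add: u_def norm_minus_commute)
    then show ?case
      by (simp add: LIM_zero_iff tendsto_norm_zero_iff)
  qed
  then show ?thesis
    unfolding strongly_measurable_def by (intro exI[of _ "\<lambda>n. s (r n + N)"]) (auto simp: sf)
qed

subsection \<open>Dyadic cubes\<close>

lemma half_open_cube_sets [measurable, simp]: "half_open_cube a l \<in> sets borel"
  unfolding half_open_cube_def by measurable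

text \<open>The cube lies between the open and the closed box with the same corners, and these have
  equal volume.\<close>

lemma emeasure_half_open_cube:
  fixes a :: "real^'n"
  assumes "0 < l"
  shows "emeasure lebesgue (half_open_cube a l) = ennreal (l ^ CARD('n))"
proof -
  let ?b = "\<chi> i. a $ i + l"
  have ab: "(?b - a) \<bullet> i = l" if "i \<in> Basis" for i
    using that by (auto simp: Basis_vec_def inner_axis)
  have le: "\<forall>i\<in>Basis. a \<bullet> i \<le> ?b \<bullet> i"
    using assms ab by (metis inner_diff_left diff_ge_0_iff_ge less_imp_le)
  have D: "(\<Prod>i\<in>Basis. (?b - a) \<bullet> i) = l ^ CARD('n)"
    using ab by simp
  have "emeasure lborel (half_open_cube a l) \<le> emeasure lborel (cbox a ?b)"
    by (intro emeasure_mono) (auto simp: half_open_cube_def mem_box_cart less_imp_le)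
  also have "\<dots> = ennreal (l ^ CARD('n))"
    using le D by (simp add: emeasure_lborel_cbox_eq)
  finally have 1: "emeasure lborel (half_open_cube a l) \<le> ennreal (l ^ CARD('n))" .
  have "ennreal (l ^ CARD('n)) = emeasure lborel (box a ?b)"
    using le D by (simp add: emeasure_lborel_box_eq)
  also have "\<dots> \<le> emeasure lborel (half_open_cube a l)"
    by (intro emeasure_mono) (auto simp: half_open_cube_def mem_box_cart less_imp_le)
  finally show ?thesis using 1 by simp
qed

lemma half_open_cube_subset_cball:
  fixes a :: "real^'n"
  assumes "x \<in> half_open_cube a l"
  shows "half_open_cube a l \<subseteq> cball x (real CARD('n) * l)"
proof
  fix y assume y: "y \<in> half_open_cube a l"
  have "norm (x - y) \<le> (\<Sum>i\<in>UNIV. \<bar>(x - y) $ i\<bar>)"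
    by (rule norm_le_l1_cart)
  also have "\<dots> \<le> (\<Sum>i\<in>(UNIV :: 'n set). l)"
  proof (rule sum_mono)
    fix i
    have "a $ i \<le> x $ i" "x $ i < a $ i + l" "a $ i \<le> y $ i" "y $ i < a $ i + l"
      using assms y by (auto simp: half_open_cube_def)
    then show "\<bar>(x - y) $ i\<bar> \<le> l" by simp
  qed
  finally show "y \<in> cball x (real CARD('n) * l)"
    by (simp add: dist_norm)
qed

text \<open>Countable additivity of both measures. It carries estimates on single selected cubes
  over to their union, one of the measures being a density with respect to the other.\<close>

lemma emeasure_Union_le_mult:
  assumes "countable G" "disjoint G" "G \<subseteq> sets M" "sets N = sets M"
    and le: "\<And>Q. Q \<in> G \<Longrightarrow> emeasure M Q \<le> c * emeasure N Q"
  shows "emeasure M (\<Union>G) \<le> c * emeasure N (\<Union>G)"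
proof -
  have d: "disjoint_family_on (\<lambda>Q. Q) G"
    using assms(2) by (auto simp: disjoint_family_on_def disjoint_def)
  have sN: "\<And>Q. Q \<in> G \<Longrightarrow> Q \<in> sets N"
    using assms by auto
  have "emeasure M (\<Union>G) = (\<integral>\<^sup>+Q. emeasure M Q \<partial>count_space G)"
    using assms emeasure_UN_countable[of G "\<lambda>Q. Q" M] d by auto
  also have "\<dots> \<le> (\<integral>\<^sup>+Q. c * emeasure N Q \<partial>count_space G)"
    by (intro nn_integral_mono) (auto intro: le)
  also have "\<dots> = c * (\<integral>\<^sup>+Q. emeasure N Q \<partial>count_space G)"
    by (intro nn_integral_cmult) auto
  also have "(\<integral>\<^sup>+Q. emeasure N Q \<partial>count_space G) = emeasure N (\<Union>G)"
    using emeasure_UN_countable[OF sN assms(1) d] by simp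
  finally show ?thesis .
qed

section \<open>Nesting, volume and shrinking of dyadic cubes\<close>

locale dyadic =
  fixes D :: "int \<Rightarrow> (real^'n) set set"
  assumes dyadic_system: "dyadic_system D"
begin

text \<open>Indexing cubes by level and point turns nesting into monotonicity in the level, and
  maximal cubes into least levels.\<close>

definition cube :: "int \<Rightarrow> real^'n \<Rightarrow> (real^'n) set" where
  "cube k x = (THE Q. Q \<in> D k \<and> x \<in> Q)"

lemma partition: "partition_on UNIV (D k)"
  using dyadic_system by (auto simp: dyadic_system_def)

lemma ex1_cube: "\<exists>!Q. Q \<in> D k \<and> x \<in> Q"
  using partition[of k] unfolding partition_on_def disjoint_def by blast

lemma cube_in [simp]: "cube k x \<in> D k" "x \<in> cube k x"
  using theI'[OF ex1_cube[of k x]] by (auto simp: cube_def)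

lemma cube_eq: "Q \<in> D k \<Longrightarrow> x \<in> Q \<Longrightarrow> cube k x = Q"
  using ex1_cube[of k x] cube_in(1)[of k x] cube_in(2)[of x k] by blast

lemma cube_cong: "y \<in> cube k x \<Longrightarrow> cube k y = cube k x"
  by (rule cube_eq) auto

lemma half_open_cubeE:
  assumes "Q \<in> D k"
  obtains a where "Q = half_open_cube a (2 powi (- k))"
proof -
  have "\<forall>Q\<in>D k. \<exists>a. Q = half_open_cube a (2 powi (- k))"
    using dyadic_system by (simp add: dyadic_system_def)
  then show thesis
    using assms that by meson
qed

lemma cube_Suc_subset: "cube (k + 1) x \<subseteq> cube k x"
proof -
  have "\<forall>Q\<in>D k. \<exists>F. F \<subseteq> D (k + 1) \<and> card F = 2 ^ CARD('n) \<and> Q = \<Union>F"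
    using dyadic_system by (simp add: dyadic_system_def)
  then obtain F where F: "F \<subseteq> D (k + 1)" "cube k x = \<Union>F"
    using cube_in(1)[of k x] by meson
  then obtain P where P: "P \<in> F" "x \<in> P"
    using cube_in(2)[of x k] by auto
  then have "cube (k + 1) x = P"
    using F by (intro cube_eq) auto
  then show ?thesis using F P by auto
qed

lemma cube_antimono: "j \<le> k \<Longrightarrow> cube k x \<subseteq> cube j x"
proof (induction k rule: int_ge_induct)
  case (step k)
  then show ?case using cube_Suc_subset[of k x] by auto
qed auto

lemma sets_D: "Q \<in> D k \<Longrightarrow> Q \<in> sets lebesgue"
  by (erule half_open_cubeE, simp only:, rule sets_completionI_sets) simp

lemma emeasure_D: "Q \<in> D k \<Longrightarrow> emeasure lebesgue Q = ennreal ((2 powi (- k)) ^ CARD('n))"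
  by (erule half_open_cubeE, simp only:, rule emeasure_half_open_cube) simp

lemma measure_D: "Q \<in> D k \<Longrightarrow> measure lebesgue Q = (2 powi (- k)) ^ CARD('n)"
  by (simp add: measure_def emeasure_D)

lemma measure_D_pos: "Q \<in> D k \<Longrightarrow> 0 < measure lebesgue Q"
  by (simp add: measure_D)

lemma emeasure_D_eq_measure: "Q \<in> D k \<Longrightarrow> emeasure lebesgue Q = ennreal (measure lebesgue Q)"
  by (simp add: measure_D emeasure_D)

lemma measure_cube_parent:
  "measure lebesgue (cube (k + 1) x) * 2 ^ CARD('n) = measure lebesgue (cube k x)"
proof -
  have "(2::real) powi (- (k + 1)) * 2 = 2 powi (- k)"
    using power_int_add[of "2::real" "- (k + 1)" 1] by simp
  then show ?thesis
    by (simp only: measure_D[OF cube_in(1)] power_mult_distrib[symmetric])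
qed

text \<open>The cube at level \<open>k + int m\<close> around \<open>x\<close> lies in a ball of
  radius \<open>CARD('n)\<close> times its sidelength, which tends to 0 as \<open>m\<close>
  grows.\<close>

lemma cube_subset_open:
  assumes "open U" "x \<in> U"
  shows "\<exists>m::nat. cube (k + int m) x \<subseteq> U"
proof -
  obtain e where e: "0 < e" "cball x e \<subseteq> U"
    using assms open_contains_cball by blast
  have "(\<lambda>m::nat. real CARD('n) * (2 powi (- k) * (1 / 2) ^ m)) \<longlonglongrightarrow> real CARD('n) * (2 powi (- k) * 0)"
    by (intro tendsto_intros) auto
  then have "\<forall>\<^sub>F m in sequentially. real CARD('n) * (2 powi (- k) * (1 / 2) ^ m) < e"
    by (rule order_tendstoD) (use e in simp)
  then obtain m :: nat where m: "real CARD('n) * (2 powi (- k) * (1 / 2) ^ m) < e"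
    by (auto simp: eventually_sequentially)
  have eq: "(2::real) powi (- (k + int m)) = 2 powi (- k) * (1 / 2) ^ m"
  proof -
    have "(2::real) powi (- (k + int m)) = 2 powi (- k + - int m)" by simp
    also have "\<dots> = 2 powi (- k) * 2 powi (- int m)" by (rule power_int_add) simp
    also have "(2::real) powi (- int m) = (1 / 2) ^ m"
      by (simp only: power_int_minus power_int_of_nat power_one_over inverse_eq_divide)
    finally show ?thesis .
  qed
  obtain a where a: "cube (k + int m) x = half_open_cube a (2 powi (- (k + int m)))"
    using half_open_cubeE[OF cube_in(1)] .
  then have "cube (k + int m) x \<subseteq> cball x (real CARD('n) * 2 powi (- (k + int m)))"
    using half_open_cube_subset_cball cube_in(2) by metis
  also have "\<dots> \<subseteq> cball x e"
    using m unfolding eq by (intro subset_cball) simp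
  finally show ?thesis using e by blast
qed

text \<open>Every cube has interior points, hence contains a point of a countable dense set, and a
  point determines its cube at level \<open>k\<close>.\<close>

lemma countable_D: "countable (D k)"
proof -
  from countable_dense_exists obtain S :: "(real^'n) set"
    where S: "countable S" "\<forall>X. open X \<longrightarrow> X \<noteq> {} \<longrightarrow> (\<exists>d\<in>S. d \<in> X)"
    by (elim exE conjE)
  have "D k \<subseteq> cube k ` S"
  proof
    fix Q assume Q: "Q \<in> D k"
    obtain a where a: "Q = half_open_cube a (2 powi (- k))"
      using half_open_cubeE[OF Q] .
    define l :: real where "l = 2 powi (- k)"
    have l: "0 < l" unfolding l_def by simp
    have "(\<chi> i. a $ i + l / 2) \<in> box a (\<chi> i. a $ i + l)"
      using l by (simp add: mem_box_cart)
    then have "box a (\<chi> i. a $ i + l) \<noteq> {}" by blast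
    from S(2)[rule_format, OF open_box this] obtain d where d: "d \<in> S" "d \<in> box a (\<chi> i. a $ i + l)" ..
    then have "d \<in> Q"
      unfolding a l_def[symmetric] by (simp add: half_open_cube_def mem_box_cart less_imp_le)
    with d(1) show "Q \<in> cube k ` S"
      by (intro image_eqI[of _ _ d]) (simp_all add: cube_eq[OF Q])
  qed
  then show ?thesis
    by (rule countable_subset) (simp add: S(1))
qed

text \<open>A stopping-time selection: descending from \<open>Q\<close> towards \<open>x\<close>,
  stop at the first cube satisfying \<open>P\<close>. The last clause records that all earlier cubes
  on the way fail \<open>P\<close>, in particular the parent of the selected one.\<close>

lemma maximal_subcubes:
  fixes P :: "(real^'n) set \<Rightarrow> bool" and k :: int
  assumes Q: "Q \<in> D k"
  obtains G where "countable G" "disjoint G" "\<Union>G = {x \<in> Q. \<exists>m::nat. P (cube (k + int m) x)}"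
    and "\<forall>A\<in>G. \<exists>x\<in>Q. \<exists>m::nat. A = cube (k + int m) x \<and> P A \<and> (\<forall>j<m. \<not> P (cube (k + int j) x))"
proof -
  define E where "E = {x \<in> Q. \<exists>m::nat. P (cube (k + int m) x)}"
  define m where "m x = (LEAST m::nat. P (cube (k + int m) x))" for x
  define A where "A x = cube (k + int (m x)) x" for x
  have PA: "P (A x)" if "x \<in> E" for x
  proof -
    from that obtain j :: nat where "P (cube (k + int j) x)"
      by (auto simp: E_def)
    then show ?thesis
      unfolding A_def m_def by (rule LeastI)
  qed
  have notP: "\<not> P (cube (k + int j) x)" if "j < m x" for x j
    using not_less_Least that unfolding m_def by blast
  have AQ: "A x \<subseteq> Q" if "x \<in> E" for x
  proof -
    have "cube k x = Q"
      using that by (intro cube_eq[OF Q]) (simp add: E_def)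
    then show ?thesis
      using cube_antimono[of k "k + int (m x)" x] by (simp add: A_def)
  qed
  \<comment> \<open>If two selected cubes share a point, the coarser one, \<open>A x\<close>, is
    also an ancestor of \<open>y\<close> satisfying \<open>P\<close>. Were \<open>m x < m y\<close>,
    the descent towards \<open>y\<close> would have stopped there.\<close>
  have eq: "A x = A y" if "x \<in> E" "y \<in> E" "z \<in> A x" "z \<in> A y" "m x \<le> m y" for x y z
  proof -
    have "z \<in> cube (k + int (m x)) y"
      using that cube_antimono[of "k + int (m x)" "k + int (m y)" y] by (auto simp: A_def)
    then have "cube (k + int (m x)) y = cube (k + int (m x)) z"
      by (rule cube_cong[symmetric])
    also have "\<dots> = A x"
      using that(3) unfolding A_def by (rule cube_cong)
    finally have "cube (k + int (m x)) y = A x" .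
    then have "\<not> m x < m y"
      using PA[OF \<open>x \<in> E\<close>] notP[of "m x" y] by auto
    then show ?thesis
      using \<open>cube (k + int (m x)) y = A x\<close> that by (simp add: A_def)
  qed
  have 1: "countable (A ` E)"
  proof (rule countable_subset)
    show "A ` E \<subseteq> (\<Union>k. D k)"
    proof (rule image_subsetI)
      fix x
      show "A x \<in> (\<Union>k. D k)"
        unfolding A_def by (rule UN_I[of "k + int (m x)"]) simp_all
    qed
  qed (simp add: countable_D)
  have 2: "disjoint (A ` E)"
  proof (rule disjointI)
    fix U V assume "U \<in> A ` E" "V \<in> A ` E" "U \<noteq> V"
    then obtain x y where "x \<in> E" "y \<in> E" "U = A x" "V = A y" "A x \<noteq> A y"
      by auto
    moreover from this have "z \<notin> A y" if "z \<in> A x" for z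
      using eq[of x y z] eq[of y x z] that nat_le_linear[of "m x" "m y"] by metis
    ultimately show "U \<inter> V = {}"
      by auto
  qed
  have 3: "\<Union>(A ` E) = {x \<in> Q. \<exists>m::nat. P (cube (k + int m) x)}"
  proof
    show "\<Union>(A ` E) \<subseteq> {x \<in> Q. \<exists>m::nat. P (cube (k + int m) x)}"
    proof safe
      fix y x assume x: "x \<in> E" "y \<in> A x"
      then show "y \<in> Q" using AQ[OF x(1)] by auto
      have "cube (k + int (m x)) y = A x"
        using x(2) unfolding A_def by (rule cube_cong)
      then show "\<exists>m::nat. P (cube (k + int m) y)"
        using PA[OF x(1)] by (intro exI[of _ "m x"]) simp
    qed
    show "{x \<in> Q. \<exists>m::nat. P (cube (k + int m) x)} \<subseteq> \<Union>(A ` E)"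
      unfolding E_def[symmetric] by (auto simp: A_def)
  qed
  have 4: "\<exists>x\<in>Q. \<exists>m::nat. U = cube (k + int m) x \<and> P U \<and> (\<forall>j<m. \<not> P (cube (k + int j) x))"
    if "U \<in> A ` E" for U
  proof -
    from that obtain x where "x \<in> E" "U = A x" by blast
    with PA notP show ?thesis
      by (intro bexI[of _ x] exI[of _ "m x"]) (simp_all add: A_def E_def)
  qed
  show thesis
    by (rule that[OF 1 2 3]) (rule ballI, rule 4)
qed

end

subsection \<open>Averages over dyadic cubes\<close>

text \<open>The function is the pointwise limit of its truncations to growing closed balls, which
  are compact.\<close>

lemma borel_measurable_locally_bochner_integrable:
  fixes f :: "real^'n \<Rightarrow> 'a::banach"
  assumes "locally_bochner_integrable f"
  shows "f \<in> borel_measurable lebesgue"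
proof (rule borel_measurable_LIMSEQ_metric)
  show "(\<lambda>x. indicator (cball 0 (real i)) x *\<^sub>R f x) \<in> borel_measurable lebesgue" for i :: nat
    using assms unfolding locally_bochner_integrable_def bochner_integrable_def has_bochner_def
    by (meson compact_cball)
  show "(\<lambda>i. indicator (cball 0 (real i)) x *\<^sub>R f x) \<longlonglongrightarrow> f x" for x
  proof (rule tendsto_eventually)
    obtain N :: nat where N: "norm x \<le> real N"
      using real_arch_simple by blast
    show "\<forall>\<^sub>F i in sequentially. indicator (cball 0 (real i)) x *\<^sub>R f x = f x"
      using eventually_ge_at_top[of N]
    proof eventually_elim
      case (elim i)
      with N have "x \<in> cball 0 (real i)" by simp
      then show ?case by simp
    qed
  qed
qed

lemma borel_measurable_norm_diff_const:
  fixes f :: "real^'n \<Rightarrow> 'a::banach"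
  assumes "locally_bochner_integrable f"
  shows "(\<lambda>x. norm (f x - v)) \<in> borel_measurable lebesgue"
  using borel_measurable_locally_bochner_integrable[OF assms]
  by (rule measurable_compose) (intro borel_measurable_continuous_onI continuous_intros)

lemma borel_measurable_ennreal_norm_diff_const:
  fixes f :: "real^'n \<Rightarrow> 'a::banach"
  assumes "locally_bochner_integrable f"
  shows "(\<lambda>x. ennreal (norm (f x - v))) \<in> borel_measurable lebesgue"
  using borel_measurable_norm_diff_const[OF assms] by (rule measurable_compose) simp

section \<open>Averages as Bochner integrals and a differentiation theorem\<close>

context dyadic
begin

text \<open>Local integrability speaks of compact sets, and a half-open cube is not compact;
  integrability is first obtained on the enclosing closed box and then restricted.\<close>

lemma has_bochner_average:
  fixes f :: "real^'n \<Rightarrow> 'a::banach"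
  assumes f: "locally_bochner_integrable f" and Q: "Q \<in> D k"
  shows "has_bochner lebesgue (\<lambda>x. indicator Q x *\<^sub>R f x) (measure lebesgue Q *\<^sub>R average f Q)"
proof -
  obtain a where a: "Q = half_open_cube a (2 powi (- k))"
    using half_open_cubeE[OF Q] .
  have "Q \<subseteq> cbox a (\<chi> i. a $ i + 2 powi (- k))"
    by (auto simp: a half_open_cube_def mem_box_cart less_imp_le)
  then have "(\<lambda>x. indicator Q x *\<^sub>R (indicator (cbox a (\<chi> i. a $ i + 2 powi (- k))) x *\<^sub>R f x))
      = (\<lambda>x. indicator Q x *\<^sub>R f x)"
    by (intro ext) (auto split: split_indicator)
  moreover have "bochner_integrable lebesgue
      (\<lambda>x. indicator Q x *\<^sub>R (indicator (cbox a (\<chi> i. a $ i + 2 powi (- k))) x *\<^sub>R f x))"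
    using f by (intro bochner_integrable_indicator[OF _ sets_D[OF Q]])
      (simp only: locally_bochner_integrable_def compact_cbox)
  ultimately have "has_bochner lebesgue (\<lambda>x. indicator Q x *\<^sub>R f x)
      (bochner_int lebesgue (\<lambda>x. indicator Q x *\<^sub>R f x))"
    using has_bochner_bochner_int by metis
  then show ?thesis
    using measure_D_pos[OF Q] by (simp add: average_def)
qed

lemma has_bochner_average_diff:
  fixes f :: "real^'n \<Rightarrow> 'a::banach"
  assumes f: "locally_bochner_integrable f" and Q: "Q \<in> D k"
  shows "has_bochner lebesgue (\<lambda>x. indicator Q x *\<^sub>R (f x - v)) (measure lebesgue Q *\<^sub>R (average f Q - v))"
  using has_bochner_indicator_diff_const[OF has_bochner_average[OF f Q] sets_D[OF Q], of v]
  by (simp add: emeasure_D[OF Q] scaleR_diff_right)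

lemma norm_average_diff_le:
  fixes f :: "real^'n \<Rightarrow> 'a::banach"
  assumes f: "locally_bochner_integrable f" and Q: "Q \<in> D k"
  shows "ennreal (measure lebesgue Q * norm (average f Q - v)) \<le> (\<integral>\<^sup>+x\<in>Q. ennreal (norm (f x - v)) \<partial>lebesgue)"
proof -
  have "ennreal (norm (measure lebesgue Q *\<^sub>R (average f Q - v)))
      \<le> (\<integral>\<^sup>+x. ennreal (norm (indicator Q x *\<^sub>R (f x - v))) \<partial>lebesgue)"
    by (rule has_bochner_norm_le[OF has_bochner_average_diff[OF assms]])
  also have "\<dots> = (\<integral>\<^sup>+x\<in>Q. ennreal (norm (f x - v)) \<partial>lebesgue)"
    by (intro nn_integral_cong) (auto simp: indicator_def)
  finally show ?thesis by simp
qed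

text \<open>
  A weak form of Lebesgue's differentiation theorem. Cover the set where \<open>g\<close> is large by the
  maximal cubes inside an open set of nearly the same measure on which the average of \<open>g\<close> is small.
\<close>

lemma AE_le_of_averages_le:
  fixes g :: "real^'n \<Rightarrow> ennreal" and c :: real
  assumes g [measurable]: "g \<in> borel_measurable lebesgue" and Q: "Q \<in> D k" and c: "0 \<le> c"
    and E [measurable]: "E \<in> sets lebesgue" and EQ: "E \<subseteq> Q"
    and avg: "\<And>x m. x \<in> E \<Longrightarrow> emeasure (density lebesgue g) (cube (k + int m) x)
        \<le> ennreal c * emeasure lebesgue (cube (k + int m) x)"
  shows "emeasure lebesgue {x \<in> E. ennreal c < g x} = 0"
proof -
  define F where "F d = {x \<in> E. ennreal (c + d) \<le> g x}" for d
  have F_sets: "F d \<in> sets lebesgue" for d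
  proof -
    have "{x \<in> space lebesgue. x \<in> E \<and> ennreal (c + d) \<le> g x} \<in> sets lebesgue"
      by measurable
    then show ?thesis by (simp add: F_def)
  qed
  have zero: "emeasure lebesgue (F d) = 0" if d: "0 < d" for d
  proof -
    let ?\<mu> = "density lebesgue g"
    \<comment> \<open>The measure of \<open>F d\<close> is a finite real \<open>r\<close>, so that
      it can be cancelled in the estimate below.\<close>
    have "emeasure lebesgue (F d) \<le> emeasure lebesgue Q"
      using EQ by (intro emeasure_mono sets_D[OF Q]) (auto simp: F_def)
    then obtain r where r: "emeasure lebesgue (F d) = ennreal r" "0 \<le> r"
      unfolding emeasure_D[OF Q] by (cases "emeasure lebesgue (F d)") (auto simp: top_unique)
    have *: "(c + d) * r \<le> c * (r + e)" if e: "0 < e" for e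
    proof -
      obtain U where U: "open U" "F d \<subseteq> U" "emeasure lebesgue (U - F d) < ennreal e"
        using sets_lebesgue_outer_open[OF F_sets e] by metis
      define P where "P A \<longleftrightarrow> A \<subseteq> U \<and> emeasure ?\<mu> A \<le> ennreal c * emeasure lebesgue A" for A
      obtain G where G: "countable G" "disjoint G" "\<Union>G = {x \<in> Q. \<exists>m::nat. P (cube (k + int m) x)}"
        and GA: "\<forall>A\<in>G. \<exists>x\<in>Q. \<exists>m::nat. A = cube (k + int m) x \<and> P A \<and>
          (\<forall>j<m. \<not> P (cube (k + int j) x))"
        using maximal_subcubes[OF Q, of P] .
      have GP: "P A" if "A \<in> G" for A
        using GA[rule_format, OF that] by (elim bexE exE conjE)
      have G_sets: "G \<subseteq> sets lebesgue"
      proof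
        fix A assume "A \<in> G"
        from GA[rule_format, OF this] obtain x m where "A = cube (k + int m) x" by (elim bexE exE conjE)
        then show "A \<in> sets lebesgue"
          using sets_D[OF cube_in(1)] by simp
      qed
      then have UG: "\<Union>G \<in> sets lebesgue"
        using G(1) by (intro sets.countable_Union) auto
      \<comment> \<open>At a point of \<open>F d\<close> the cubes eventually fit into the open set
        \<open>U\<close>, and their averages are small by \<open>avg\<close>; hence one of them
        satisfies \<open>P\<close>.\<close>
      have FG: "F d \<subseteq> \<Union>G"
      proof
        fix x assume x: "x \<in> F d"
        then obtain m :: nat where "cube (k + int m) x \<subseteq> U"
          using cube_subset_open[OF U(1)] U(2) by blast
        with x avg[of x m] EQ show "x \<in> \<Union>G"
          unfolding G(3) F_def P_def by blast
      qed
      have "ennreal ((c + d) * r) = ennreal (c + d) * emeasure lebesgue (F d)"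
        using c d r by (simp add: ennreal_mult)
      also have "\<dots> = (\<integral>\<^sup>+x. ennreal (c + d) * indicator (F d) x \<partial>lebesgue)"
        using F_sets by (simp add: nn_integral_cmult_indicator)
      also have "\<dots> \<le> (\<integral>\<^sup>+x. g x * indicator (F d) x \<partial>lebesgue)"
        by (intro nn_integral_mono) (auto simp: F_def indicator_def)
      also have "\<dots> = emeasure ?\<mu> (F d)"
        using F_sets by (simp add: emeasure_density)
      also have "\<dots> \<le> emeasure ?\<mu> (\<Union>G)"
        using FG UG by (intro emeasure_mono) auto
      also have "\<dots> \<le> ennreal c * emeasure lebesgue (\<Union>G)"
        using G(1,2) G_sets GP by (intro emeasure_Union_le_mult) (auto simp: P_def)
      also have "emeasure lebesgue (\<Union>G) \<le> emeasure lebesgue (F d \<union> (U - F d))"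
        using GP U(1) F_sets by (intro emeasure_mono) (auto simp: P_def)
      also have "\<dots> \<le> emeasure lebesgue (F d) + emeasure lebesgue (U - F d)"
        using U(1) F_sets by (intro emeasure_subadditive) auto
      also have "\<dots> \<le> ennreal r + ennreal e"
        using U(3) by (simp add: r(1) add_left_mono less_imp_le)
      finally have "ennreal ((c + d) * r) \<le> ennreal c * (ennreal r + ennreal e)"
        by (simp add: mult_left_mono)
      then show ?thesis
        using c e r by (simp flip: ennreal_plus ennreal_mult)
    qed
    have "r = 0"
    proof (rule ccontr)
      assume "r \<noteq> 0"
      \<comment> \<open>The estimate amounts to \<open>d * r \<le> c * e\<close> for every positive
        \<open>e\<close>. With this \<open>e\<close> the right-hand side is at most
        \<open>d * r / 2\<close>; the summand 1 covers \<open>c = 0\<close>.\<close>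
      with r have "0 < d * r / (2 * (c + 1))" using c d by simp
      from *[OF this] have "d * r \<le> c * (d * r / (2 * (c + 1)))"
        by (simp add: algebra_simps)
      also have "\<dots> = (c / (c + 1)) * (d * r / 2)"
        using c by (simp add: field_simps)
      also have "\<dots> \<le> 1 * (d * r / 2)"
        using c d r by (intro mult_right_mono) auto
      finally show False
        using \<open>r \<noteq> 0\<close> r(2) d by simp
    qed
    then show ?thesis using r by simp
  qed
  \<comment> \<open>The strict inequality is exhausted by countably many margins \<open>d\<close>,
    each of which contributes a null set.\<close>
  have "{x \<in> E. ennreal c < g x} \<subseteq> (\<Union>n. F (1 / real (Suc n)))"
  proof safe
    fix x assume x: "x \<in> E" "ennreal c < g x"
    show "x \<in> (\<Union>n. F (1 / real (Suc n)))"
    proof (cases "g x")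
      case (real r)
      with x c have "0 < r - c" by (simp add: ennreal_less_iff)
      then obtain n where "inverse (real (Suc n)) < r - c"
        using reals_Archimedean by blast
      then have "c + 1 / real (Suc n) \<le> r"
        by (simp add: inverse_eq_divide)
      then have "x \<in> F (1 / real (Suc n))"
        using x real by (auto simp: F_def intro!: ennreal_leI simp del: of_nat_Suc)
      then show ?thesis by blast
    next
      case top
      then have "x \<in> F (1 / real (Suc 0))"
        using x by (simp add: F_def)
      then show ?thesis by blast
    qed
  qed
  then have "emeasure lebesgue {x \<in> E. ennreal c < g x} \<le> emeasure lebesgue (\<Union>n. F (1 / real (Suc n)))"
    using F_sets by (intro emeasure_mono) auto
  also have "\<dots> = 0"
    using F_sets zero by (intro emeasure_UN_eq_0) auto
  finally show ?thesis by simp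
qed

end

subsection \<open>The John--Nirenberg inequality\<close>

context dyadic
begin

definition oscillation_bounded :: "(real^'n \<Rightarrow> 'a::banach) \<Rightarrow> real \<Rightarrow> bool" where
  "oscillation_bounded f B \<longleftrightarrow> (\<forall>k. \<forall>Q\<in>D k.
     (\<integral>\<^sup>+x\<in>Q. ennreal (norm (f x - average f Q)) \<partial>lebesgue) \<le> ennreal B * emeasure lebesgue Q)"

lemma oscillation_boundedD:
  "oscillation_bounded f B \<Longrightarrow> Q \<in> D k \<Longrightarrow>
    (\<integral>\<^sup>+x\<in>Q. ennreal (norm (f x - average f Q)) \<partial>lebesgue) \<le> ennreal B * emeasure lebesgue Q"
  by (simp add: oscillation_bounded_def)

text \<open>Calderon--Zygmund decomposition at height \<open>2 * B\<close>. The selected cubes fill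
  at most half of \<open>Q\<close>, and outside them the deviation is almost everywhere at most
  \<open>2 * B\<close>. Inside a selected cube \<open>A\<close>, deviating from
  \<open>average f Q\<close> by more than \<open>s\<close> plus the jump of the averages forces a
  deviation of more than \<open>s\<close> from \<open>average f A\<close>, to which
  \<open>IH\<close> applies.\<close>

lemma john_nirenberg_step:
  fixes f :: "real^'n \<Rightarrow> 'a::banach"
  assumes f: "locally_bochner_integrable f" and B: "0 < B" and osc: "oscillation_bounded f B"
    and s: "0 \<le> s" and t: "0 \<le> t"
    and IH: "\<And>k Q. Q \<in> D k \<Longrightarrow>
      emeasure lebesgue {x \<in> Q. s < norm (f x - average f Q)} \<le> ennreal t * emeasure lebesgue Q"
    and Q: "Q \<in> D k"
  shows "emeasure lebesgue {x \<in> Q. s + 2 ^ (CARD('n) + 1) * B < norm (f x - average f Q)}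
    \<le> ennreal (t / 2) * emeasure lebesgue Q"
proof -
  let ?L = "2 ^ (CARD('n) + 1) * B"
  define v where "v = average f Q"
  define g where "g x = ennreal (norm (f x - v))" for x
  define \<mu> where "\<mu> = density lebesgue g"
  define P where "P A \<longleftrightarrow> ennreal (2 * B) * emeasure lebesgue A < emeasure \<mu> A" for A
  have g: "g \<in> borel_measurable lebesgue"
    unfolding g_def using f by (rule borel_measurable_ennreal_norm_diff_const)
  have sets_\<mu>: "sets \<mu> = sets lebesgue"
    by (simp add: \<mu>_def)
  have \<mu>: "emeasure \<mu> A = (\<integral>\<^sup>+x\<in>A. g x \<partial>lebesgue)" if "A \<in> sets lebesgue" for A
    using g that by (simp add: \<mu>_def emeasure_density)
  \<comment> \<open>The oscillation bound on \<open>Q\<close> is half the selection height. Thus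
    \<open>Q\<close> is not selected, and every selected cube has a parent inside
    \<open>Q\<close>.\<close>
  have "emeasure \<mu> Q \<le> ennreal B * emeasure lebesgue Q"
    using oscillation_boundedD[OF osc Q] by (simp add: \<mu>[OF sets_D[OF Q]] g_def v_def)
  also have "\<dots> \<le> ennreal (2 * B) * emeasure lebesgue Q"
    using B by (intro mult_right_mono ennreal_leI) auto
  finally have notPQ: "\<not> P Q"
    by (simp add: P_def not_less)
  obtain G where G: "countable G" "disjoint G" "\<Union>G = {x \<in> Q. \<exists>m::nat. P (cube (k + int m) x)}"
    and GA: "\<forall>A\<in>G. \<exists>x\<in>Q. \<exists>m::nat. A = cube (k + int m) x \<and> P A \<and>
      (\<forall>j<m. \<not> P (cube (k + int j) x))"
    using maximal_subcubes[OF Q, of P] .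
  have G_sets: "G \<subseteq> sets lebesgue"
  proof
    fix A assume "A \<in> G"
    from GA[rule_format, OF this] obtain x m where "A = cube (k + int m) x" by (elim bexE exE conjE)
    then show "A \<in> sets lebesgue"
      using sets_D[OF cube_in(1)] by simp
  qed
  then have UG: "\<Union>G \<in> sets lebesgue"
    using G(1) by (intro sets.countable_Union) auto

  have small: "emeasure lebesgue (\<Union>G) \<le> ennreal (1 / 2) * emeasure lebesgue Q"
  proof -
    \<comment> \<open>A Chebyshev estimate: each selected cube has \<open>\<mu>\<close>-measure
      above \<open>2 * B\<close> times its volume, while \<open>Q\<close> has at most
      \<open>B\<close> times its volume.\<close>
    have "emeasure lebesgue (\<Union>G) \<le> ennreal (1 / (2 * B)) * emeasure \<mu> (\<Union>G)"
    proof (rule emeasure_Union_le_mult[OF G(1,2) G_sets sets_\<mu>])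
      fix A assume "A \<in> G"
      then have "P A"
        using GA by (elim ballE bexE exE conjE) auto
      then have "ennreal (1 / (2 * B)) * (ennreal (2 * B) * emeasure lebesgue A)
          \<le> ennreal (1 / (2 * B)) * emeasure \<mu> A"
        unfolding P_def by (intro mult_left_mono) auto
      moreover have "ennreal (1 / (2 * B)) * (ennreal (2 * B) * emeasure lebesgue A) = emeasure lebesgue A"
        using B by (simp add: mult.assoc[symmetric] flip: ennreal_mult)
      ultimately show "emeasure lebesgue A \<le> ennreal (1 / (2 * B)) * emeasure \<mu> A"
        by simp
    qed
    also have "\<dots> \<le> ennreal (1 / (2 * B)) * emeasure \<mu> Q"
      using sets_D[OF Q] by (intro mult_left_mono emeasure_mono) (auto simp: G(3) sets_\<mu>)
    also have "\<dots> \<le> ennreal (1 / (2 * B)) * (ennreal B * emeasure lebesgue Q)"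
      using \<open>emeasure \<mu> Q \<le> ennreal B * emeasure lebesgue Q\<close> by (rule mult_left_mono) simp
    also have "\<dots> = ennreal (1 / 2) * emeasure lebesgue Q"
      using B by (simp add: mult.assoc[symmetric] flip: ennreal_mult)
    finally show ?thesis .
  qed

  text \<open>The parent of a maximal cube is not selected, so the averages jump by at most \<open>?L\<close>.\<close>
  have jump: "norm (average f A - v) \<le> ?L" and in_D: "\<exists>j. A \<in> D j" if A: "A \<in> G" for A
  proof -
    from GA[rule_format, OF A] obtain x m
      where x: "x \<in> Q" and m: "A = cube (k + int m) x" "P A" "\<forall>j<m. \<not> P (cube (k + int j) x)"
      by (elim bexE exE conjE)
    show "\<exists>j. A \<in> D j"
      using m(1) cube_in(1) by blast
    have "m \<noteq> 0"
    proof
      assume "m = 0"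
      then have "A = Q" using m(1) cube_eq[OF Q x] by simp
      with m(2) notPQ show False by simp
    qed
    then obtain j where j: "m = Suc j"
      using not0_implies_Suc by blast
    let ?R = "cube (k + int j) x"
    have A_eq: "A = cube ((k + int j) + 1) x"
      using m(1) j by (simp add: ac_simps)
    have A_D: "A \<in> D ((k + int j) + 1)"
      unfolding A_eq by simp
    have "ennreal (measure lebesgue A * norm (average f A - v)) \<le> emeasure \<mu> A"
      using norm_average_diff_le[OF f A_D, of v] by (simp add: \<mu>[OF sets_D[OF A_D]] g_def)
    also have "\<dots> \<le> emeasure \<mu> ?R"
      using cube_Suc_subset[of "k + int j" x] sets_D[OF cube_in(1)]
      by (intro emeasure_mono) (simp_all add: A_eq sets_\<mu>)
    also have "\<dots> \<le> ennreal (2 * B) * emeasure lebesgue ?R"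
      using m(3) j by (simp add: P_def not_less)
    also have "\<dots> = ennreal (2 * B * measure lebesgue ?R)"
      using B by (simp add: emeasure_D_eq_measure[OF cube_in(1)] ennreal_mult)
    \<comment> \<open>The parent has \<open>2 ^ CARD('n)\<close> times the volume of
      \<open>A\<close>; together with the height \<open>2 * B\<close> this explains the value of
      \<open>?L\<close>.\<close>
    also have "2 * B * measure lebesgue ?R = measure lebesgue A * ?L"
      using measure_cube_parent[of "k + int j" x] by (simp add: A_eq)
    finally have "measure lebesgue A * norm (average f A - v) \<le> measure lebesgue A * ?L"
      using B by (simp add: ennreal_le_iff)
    then show "norm (average f A - v) \<le> ?L"
      using measure_D_pos[OF A_D] by simp
  qed

  define H where "H = {x \<in> Q. s + ?L < norm (f x - v)}"
  have meas: "{x \<in> A. r < norm (f x - w)} \<in> sets lebesgue" if "A \<in> sets lebesgue" for A r w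
  proof -
    note [measurable] = that borel_measurable_norm_diff_const[OF f]
    have "{x \<in> space lebesgue. x \<in> A \<and> r < norm (f x - w)} \<in> sets lebesgue"
      by measurable
    then show ?thesis by simp
  qed
  have H: "H \<in> sets lebesgue"
    unfolding H_def using sets_D[OF Q] by (rule meas)
  have E: "Q - \<Union>G \<in> sets lebesgue"
    using sets_D[OF Q] UG by (rule sets.Diff)
  \<comment> \<open>No cube below \<open>Q\<close> around an unselected point satisfies
    \<open>P\<close>, so all these averages of \<open>g\<close> are at most \<open>2 * B\<close> and
    the differentiation result applies.\<close>
  have "emeasure lebesgue {x \<in> Q - \<Union>G. ennreal (2 * B) < g x} = 0"
  proof (rule AE_le_of_averages_le[OF g Q _ E])
    fix x m assume "x \<in> Q - \<Union>G"
    then have "\<not> P (cube (k + int m) x)"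
      by (auto simp: G(3))
    then show "emeasure (density lebesgue g) (cube (k + int m) x)
        \<le> ennreal (2 * B) * emeasure lebesgue (cube (k + int m) x)"
      by (simp add: P_def \<mu>_def not_less)
  qed (use B in auto)
  moreover have "{x \<in> Q - \<Union>G. ennreal (2 * B) < g x} = {x \<in> Q - \<Union>G. 2 * B < norm (f x - v)}"
    using B by (auto simp: g_def ennreal_less_iff)
  ultimately have zero: "emeasure lebesgue {x \<in> Q - \<Union>G. 2 * B < norm (f x - v)} = 0"
    by simp
  have "(1::real) \<le> 2 ^ CARD('n)"
    by simp
  then have "2 * B * 1 \<le> 2 * B * 2 ^ CARD('n)"
    using B by (intro mult_left_mono) auto
  then have L: "2 * B \<le> s + ?L"
    using s by (simp add: algebra_simps)
  \<comment> \<open>Restriction to \<open>H\<close> is written as a density so that the comparison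
    of measures can be made cube by cube.\<close>
  have "emeasure lebesgue (H \<inter> \<Union>G) = emeasure (density lebesgue (indicator H)) (\<Union>G)"
    using H UG by (simp add: emeasure_restricted)
  also have "\<dots> \<le> ennreal t * emeasure lebesgue (\<Union>G)"
  proof (rule emeasure_Union_le_mult[OF G(1,2)])
    fix A assume A: "A \<in> G"
    then obtain j where A_D: "A \<in> D j"
      using in_D by blast
    have "emeasure (density lebesgue (indicator H)) A = emeasure lebesgue (H \<inter> A)"
      using H sets_D[OF A_D] by (simp add: emeasure_restricted)
    also have "\<dots> \<le> emeasure lebesgue {x \<in> A. s < norm (f x - average f A)}"
    proof (intro emeasure_mono meas sets_D[OF A_D] subsetI)
      fix x assume "x \<in> H \<inter> A"
      moreover have "norm (f x - v) \<le> norm (f x - average f A) + norm (average f A - v)"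
        using norm_triangle_ineq[of "f x - average f A" "average f A - v"] by simp
      ultimately show "x \<in> {x \<in> A. s < norm (f x - average f A)}"
        using jump[OF A] by (simp add: H_def)
    qed
    also have "\<dots> \<le> ennreal t * emeasure lebesgue A"
      using A_D by (rule IH)
    finally show "emeasure (density lebesgue (indicator H)) A \<le> ennreal t * emeasure lebesgue A" .
  qed (use G_sets in auto)
  also have "\<dots> \<le> ennreal t * (ennreal (1 / 2) * emeasure lebesgue Q)"
    using small by (rule mult_left_mono) simp
  also have "\<dots> = ennreal (t / 2) * emeasure lebesgue Q"
    using t ennreal_mult[of t "1 / 2"] by (simp add: mult.assoc[symmetric])
  finally have HG: "emeasure lebesgue (H \<inter> \<Union>G) \<le> ennreal (t / 2) * emeasure lebesgue Q" .
  have "emeasure lebesgue H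
      \<le> emeasure lebesgue ({x \<in> Q - \<Union>G. 2 * B < norm (f x - v)} \<union> (H \<inter> \<Union>G))"
  proof (rule emeasure_mono)
    show "H \<subseteq> {x \<in> Q - \<Union>G. 2 * B < norm (f x - v)} \<union> (H \<inter> \<Union>G)"
    proof
      fix x assume x: "x \<in> H"
      then have "x \<in> Q" "2 * B < norm (f x - v)"
        using L unfolding H_def by simp_all
      with x show "x \<in> {x \<in> Q - \<Union>G. 2 * B < norm (f x - v)} \<union> (H \<inter> \<Union>G)"
        by blast
    qed
  qed (intro sets.Un sets.Int meas[OF E] H UG)
  also have "\<dots> \<le> emeasure lebesgue {x \<in> Q - \<Union>G. 2 * B < norm (f x - v)} + emeasure lebesgue (H \<inter> \<Union>G)"
    by (intro emeasure_subadditive sets.Int meas[OF E] H UG)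
  also have "\<dots> \<le> ennreal (t / 2) * emeasure lebesgue Q"
    unfolding zero add_0 by (rule HG)
  finally show ?thesis
    unfolding H_def v_def .
qed

text \<open>Iteration of the step: each further unit of \<open>2 ^ (CARD('n) + 1) * B\<close> in the
  threshold halves the measure, starting from the trivial bound by all of \<open>Q\<close>.\<close>

lemma john_nirenberg_distribution:
  fixes f :: "real^'n \<Rightarrow> 'a::banach"
  assumes f: "locally_bochner_integrable f" and B: "0 < B" and osc: "oscillation_bounded f B"
    and Q: "Q \<in> D k"
  shows "emeasure lebesgue {x \<in> Q. real i * (2 ^ (CARD('n) + 1) * B) < norm (f x - average f Q)}
    \<le> ennreal ((1 / 2) ^ i) * emeasure lebesgue Q"
  using Q
proof (induction i arbitrary: k Q)
  case 0
  then show ?case by (auto intro!: emeasure_mono sets_D)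
next
  case (Suc i)
  have eq: "real (Suc i) * (2 ^ (CARD('n) + 1) * B)
      = real i * (2 ^ (CARD('n) + 1) * B) + 2 ^ (CARD('n) + 1) * B"
    "(1 / 2 :: real) ^ Suc i = (1 / 2) ^ i / 2"
    by (simp_all add: algebra_simps)
  show ?case
    unfolding eq by (rule john_nirenberg_step[OF f B osc _ _ Suc.IH Suc.prems]) (use B in auto)
qed

text \<open>The \<open>i\<close>-th term bounds the contribution, for \<open>B = 1\<close>, of the
  shell where the deviation lies between \<open>i\<close> and \<open>Suc i\<close> multiples of
  \<open>2 ^ (CARD('n) + 1)\<close>: upper value to the power \<open>p\<close> times relative
  measure.\<close>

definition john_nirenberg_const :: "real \<Rightarrow> real" where
  "john_nirenberg_const p =
     (\<Sum>i. (real (Suc i) * 2 ^ (CARD('n) + 1)) powr p * (1 / 2) ^ i)"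

text \<open>Polynomial growth is absorbed by passing from ratio 1/2 to ratio 3/4.\<close>

lemma summable_john_nirenberg:
  "summable (\<lambda>i. (real (Suc i) * 2 ^ (CARD('n) + 1)) powr p * (1 / 2) ^ i)"
proof (rule summable_comparison_test_bigo)
  show "summable (\<lambda>i. norm ((3 / 4 :: real) ^ i))"
    by (simp add: summable_geometric)
  have "(\<lambda>i. (real (Suc i) * L) powr p * (1 / 2) ^ i) \<in> O(\<lambda>i. (3 / 4) ^ i)" if "0 < L" for L :: real
    using that by real_asymp
  then show "(\<lambda>i. (real (Suc i) * 2 ^ (CARD('n) + 1)) powr p * (1 / 2) ^ i) \<in> O(\<lambda>i. (3 / 4) ^ i)"
    by simp
qed

lemma john_nirenberg_const_nonneg: "0 \<le> john_nirenberg_const p"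
  unfolding john_nirenberg_const_def by (intro suminf_nonneg summable_john_nirenberg) simp

text \<open>Layer-by-layer summation of the exponential decay of the distribution function;
  \<open>B\<close> scales out as \<open>B powr p\<close>.\<close>

lemma john_nirenberg:
  fixes f :: "real^'n \<Rightarrow> 'a::banach"
  assumes f: "locally_bochner_integrable f" and B: "0 < B" and osc: "oscillation_bounded f B"
    and Q: "Q \<in> D k" and p: "0 < p"
  shows "(\<integral>\<^sup>+x\<in>Q. ennreal (norm (f x - average f Q) powr p) \<partial>lebesgue)
    \<le> ennreal (john_nirenberg_const p * B powr p) * emeasure lebesgue Q"
proof -
  let ?L = "2 ^ (CARD('n) + 1) * B"
  define g where "g x = norm (f x - average f Q)" for x
  define S where "S i = {x \<in> Q. real i * ?L < g x}" for i
  define a where "a i = (real (Suc i) * 2 ^ (CARD('n) + 1)) powr p * (1 / 2) ^ i" for i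
  have S: "S i \<in> sets lebesgue" for i
  proof -
    note [measurable] = sets_D[OF Q] borel_measurable_norm_diff_const[OF f]
    have "{x \<in> space lebesgue. x \<in> Q \<and> real i * ?L < norm (f x - average f Q)} \<in> sets lebesgue"
      by measurable
    then show ?thesis
      unfolding S_def g_def by (simp only: space_completion space_lborel space_borel UNIV_I simp_thms)
  qed
  have term_le: "h i \<le> suminf h" for h :: "nat \<Rightarrow> ennreal" and i
    using sum_le_suminf[OF summableI, of "{i}" h] by simp
  have le: "ennreal (g x powr p) * indicator Q x \<le> (\<Sum>i. ennreal ((real (Suc i) * ?L) powr p) * indicator (S i) x)"
    for x
  proof (cases "x \<in> Q \<and> 0 < g x")
    case True
    \<comment> \<open>The index of the shell open below and closed above that contains
      \<open>g x\<close>, matching the strict inequality in \<open>S\<close>.\<close>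
    define i where "i = nat (\<lceil>g x / ?L\<rceil> - 1)"
    have L: "0 < ?L" using B by simp
    have "0 < g x / ?L" using True L by simp
    then have "real i < g x / ?L" "g x / ?L \<le> real (Suc i)"
      unfolding i_def by linarith+
    then have i: "real i * ?L < g x" "g x \<le> real (Suc i) * ?L"
      using L by (simp_all add: pos_less_divide_eq pos_divide_le_eq)
    have "ennreal (g x powr p) * indicator Q x \<le> ennreal ((real (Suc i) * ?L) powr p) * indicator (S i) x"
      using True i p by (auto simp: S_def intro!: ennreal_leI powr_mono2)
    also have "\<dots> \<le> (\<Sum>i. ennreal ((real (Suc i) * ?L) powr p) * indicator (S i) x)"
      by (rule term_le)
    finally show ?thesis .
  next
    case False
    then have "ennreal (g x powr p) * indicator Q x = 0"
      by (auto simp: g_def)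
    then show ?thesis by (simp only: zero_le)
  qed
  have a: "(real (Suc i) * ?L) powr p * (1 / 2) ^ i = B powr p * a i" for i
    using B by (simp add: a_def powr_mult[symmetric] ac_simps)
  have sa: "summable a" and const: "john_nirenberg_const p = suminf a"
    unfolding a_def[abs_def] john_nirenberg_const_def by (rule summable_john_nirenberg, rule refl)
  have "(\<integral>\<^sup>+x\<in>Q. ennreal (g x powr p) \<partial>lebesgue)
      \<le> (\<integral>\<^sup>+x. (\<Sum>i. ennreal ((real (Suc i) * ?L) powr p) * indicator (S i) x) \<partial>lebesgue)"
    by (intro nn_integral_mono le)
  also have "\<dots> = (\<Sum>i. ennreal ((real (Suc i) * ?L) powr p) * emeasure lebesgue (S i))"
    using S by (subst nn_integral_suminf) (auto simp: nn_integral_cmult_indicator)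
  also have "\<dots> \<le> (\<Sum>i. ennreal (B powr p * a i) * emeasure lebesgue Q)"
  proof (intro suminf_le summableI)
    fix i
    have "ennreal ((real (Suc i) * ?L) powr p) * emeasure lebesgue (S i)
        \<le> ennreal ((real (Suc i) * ?L) powr p) * (ennreal ((1 / 2) ^ i) * emeasure lebesgue Q)"
      using john_nirenberg_distribution[OF f B osc Q, of i]
      unfolding S_def g_def by (rule mult_left_mono) simp
    also have "\<dots> = ennreal (B powr p * a i) * emeasure lebesgue Q"
      unfolding a[symmetric] by (simp add: ennreal_mult mult.assoc)
    finally show "ennreal ((real (Suc i) * ?L) powr p) * emeasure lebesgue (S i)
        \<le> ennreal (B powr p * a i) * emeasure lebesgue Q" .
  qed
  also have "\<dots> = (\<Sum>i. ennreal (B powr p * a i)) * emeasure lebesgue Q"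
    by (rule ennreal_suminf_multc)
  also have "(\<Sum>i. ennreal (B powr p * a i)) = ennreal (\<Sum>i. B powr p * a i)"
    by (intro suminf_ennreal2 summable_mult sa) (simp add: a_def)
  also have "(\<Sum>i. B powr p * a i) = john_nirenberg_const p * B powr p"
    using sa by (simp add: suminf_mult const)
  finally show ?thesis
    by (simp add: g_def)
qed

end

subsection \<open>R-bounds\<close>

text \<open>Isolates the condition under the infimum in \<open>Rbound\<close>, so that constants can
  be added before infima are taken.\<close>

definition Rbound_admissible :: "('k::real_normed_field \<Rightarrow> 'a::banach \<Rightarrow> 'a) \<Rightarrow> 'a set \<Rightarrow> real \<Rightarrow> bool" where
  "Rbound_admissible sc S C \<longleftrightarrow> C \<ge> 0 \<and>
     (\<forall>(N::nat) \<xi> c. (\<forall>k<N. \<xi> k \<in> S) \<longrightarrow>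
        sqrt (measure_pmf.expectation (rademacher_pmf N)
                (\<lambda>\<epsilon>. (norm (\<Sum>k<N. \<epsilon> k *\<^sub>R sc (c k) (\<xi> k)))\<^sup>2))
        \<le> C * sqrt (\<Sum>k<N. (norm (c k))\<^sup>2))"

lemma Rbound_eq_Inf: "Rbound sc S = Inf {ennreal C | C. Rbound_admissible sc S C}"
  by (simp add: Rbound_def Rbound_admissible_def)

lemma Rbound_le: "Rbound_admissible sc S C \<Longrightarrow> Rbound sc S \<le> ennreal C"
  unfolding Rbound_eq_Inf by (rule Inf_lower) blast

lemma Rbound_mono:
  assumes "S \<subseteq> T"
  shows "Rbound sc S \<le> Rbound sc T"
proof -
  have "Rbound_admissible sc S C" if "Rbound_admissible sc T C" for C
    using that assms unfolding Rbound_admissible_def by (meson subsetD)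
  then show ?thesis
    unfolding Rbound_eq_Inf by (intro Inf_superset_mono) blast
qed

lemma finite_set_rademacher_pmf: "finite (set_pmf (rademacher_pmf N))"
  unfolding rademacher_pmf_def
  by (subst set_Pi_pmf) (auto intro!: finite_PiE_dflt)

text \<open>Minkowski's inequality in L^2. With finite support the expectation is a finite sum, and
  moving the square root of each probability into the summand turns it into
  \<open>L2_set\<close>.\<close>

lemma sqrt_expectation_norm_add_le:
  fixes X Y :: "'b \<Rightarrow> 'a::real_normed_vector"
  assumes fin: "finite (set_pmf M)"
  shows "sqrt (measure_pmf.expectation M (\<lambda>\<epsilon>. (norm (X \<epsilon> + Y \<epsilon>))\<^sup>2))
    \<le> sqrt (measure_pmf.expectation M (\<lambda>\<epsilon>. (norm (X \<epsilon>))\<^sup>2))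
      + sqrt (measure_pmf.expectation M (\<lambda>\<epsilon>. (norm (Y \<epsilon>))\<^sup>2))"
proof -
  have eq: "sqrt (measure_pmf.expectation M (\<lambda>\<epsilon>. (norm (Z \<epsilon>))\<^sup>2))
      = L2_set (\<lambda>\<epsilon>. sqrt (pmf M \<epsilon>) * norm (Z \<epsilon>)) (set_pmf M)" for Z :: "'b \<Rightarrow> 'a"
    unfolding L2_set_def
    by (subst integral_measure_pmf_real[OF fin])
      (auto simp: power_mult_distrib set_pmf_iff mult.commute intro!: sum.cong)
  have "L2_set (\<lambda>\<epsilon>. sqrt (pmf M \<epsilon>) * norm (X \<epsilon> + Y \<epsilon>)) (set_pmf M)
      \<le> L2_set (\<lambda>\<epsilon>. sqrt (pmf M \<epsilon>) * norm (X \<epsilon>) + sqrt (pmf M \<epsilon>) * norm (Y \<epsilon>)) (set_pmf M)"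
    by (intro L2_set_mono) (auto simp: distrib_left[symmetric] intro!: mult_left_mono norm_triangle_ineq)
  also have "\<dots> \<le> L2_set (\<lambda>\<epsilon>. sqrt (pmf M \<epsilon>) * norm (X \<epsilon>)) (set_pmf M)
      + L2_set (\<lambda>\<epsilon>. sqrt (pmf M \<epsilon>) * norm (Y \<epsilon>)) (set_pmf M)"
    by (rule L2_set_triangle_ineq)
  finally show ?thesis
    unfolding eq .
qed

text \<open>Splitting each vector of a family in \<open>S\<close> into its two summands, with the
  same scalars and signs, and applying Minkowski's inequality to the two random sums.\<close>

lemma Rbound_admissible_add:
  assumes sc: "banach_scaling sc"
    and A: "Rbound_admissible sc A a" and B: "Rbound_admissible sc B b"
    and S: "\<And>z. z \<in> S \<Longrightarrow> \<exists>x\<in>A. \<exists>y\<in>B. z = x + y"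
  shows "Rbound_admissible sc S (a + b)"
  unfolding Rbound_admissible_def
proof (intro conjI allI impI)
  show "0 \<le> a + b"
    using A B by (simp add: Rbound_admissible_def)
  fix N :: nat and \<xi> c
  assume "\<forall>k<N. \<xi> k \<in> S"
  then have "\<exists>x y. k < N \<longrightarrow> x \<in> A \<and> y \<in> B \<and> \<xi> k = x + y" for k
    using S by blast
  then obtain x y where xy: "\<And>k. k < N \<Longrightarrow> x k \<in> A \<and> y k \<in> B \<and> \<xi> k = x k + y k"
    by metis
  have add: "sc u (v + w) = sc u v + sc u w" for u v w
    using sc by (simp add: banach_scaling_def vector_space_def)
  have "(\<Sum>k<N. \<epsilon> k *\<^sub>R sc (c k) (\<xi> k))
      = (\<Sum>k<N. \<epsilon> k *\<^sub>R sc (c k) (x k)) + (\<Sum>k<N. \<epsilon> k *\<^sub>R sc (c k) (y k))" for \<epsilon>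
    using xy by (simp add: sum.distrib[symmetric] add scaleR_add_right)
  then have "sqrt (measure_pmf.expectation (rademacher_pmf N)
        (\<lambda>\<epsilon>. (norm (\<Sum>k<N. \<epsilon> k *\<^sub>R sc (c k) (\<xi> k)))\<^sup>2))
      \<le> sqrt (measure_pmf.expectation (rademacher_pmf N)
          (\<lambda>\<epsilon>. (norm (\<Sum>k<N. \<epsilon> k *\<^sub>R sc (c k) (x k)))\<^sup>2))
        + sqrt (measure_pmf.expectation (rademacher_pmf N)
          (\<lambda>\<epsilon>. (norm (\<Sum>k<N. \<epsilon> k *\<^sub>R sc (c k) (y k)))\<^sup>2))"
    by (simp only: sqrt_expectation_norm_add_le[OF finite_set_rademacher_pmf])
  also have "\<dots> \<le> a * sqrt (\<Sum>k<N. (norm (c k))\<^sup>2) + b * sqrt (\<Sum>k<N. (norm (c k))\<^sup>2)"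
    using A B xy unfolding Rbound_admissible_def by (intro add_mono) blast+
  finally show "sqrt (measure_pmf.expectation (rademacher_pmf N)
        (\<lambda>\<epsilon>. (norm (\<Sum>k<N. \<epsilon> k *\<^sub>R sc (c k) (\<xi> k)))\<^sup>2))
      \<le> (a + b) * sqrt (\<Sum>k<N. (norm (c k))\<^sup>2)"
    by (simp add: distrib_right)
qed

lemma Rbound_add_le:
  assumes sc: "banach_scaling sc"
    and S: "\<And>z. z \<in> S \<Longrightarrow> \<exists>x\<in>A. \<exists>y\<in>B. z = x + y"
  shows "Rbound sc S \<le> Rbound sc A + Rbound sc B"
proof (rule ennreal_le_epsilon)
  fix e :: real
  assume fin: "Rbound sc A + Rbound sc B < top" and e: "0 < e"
  \<comment> \<open>The infimum need not be known to be attained, so constants within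
    \<open>e / 2\<close> of it are used.\<close>
  have near: "\<exists>C. Rbound_admissible sc T C \<and> ennreal C < Rbound sc T + ennreal (e / 2)"
    if "Rbound sc T < top" for T
  proof -
    have "Rbound sc T < Rbound sc T + ennreal (e / 2)"
      using that e by (cases "Rbound sc T") (auto simp flip: ennreal_plus simp: ennreal_less_iff)
    then show ?thesis
      unfolding Rbound_eq_Inf[of sc T] Inf_less_iff by blast
  qed
  obtain a b where a: "Rbound_admissible sc A a" "ennreal a < Rbound sc A + ennreal (e / 2)"
    and b: "Rbound_admissible sc B b" "ennreal b < Rbound sc B + ennreal (e / 2)"
    using near[of A] near[of B] fin by auto
  have "Rbound sc S \<le> ennreal (a + b)"
    by (rule Rbound_le[OF Rbound_admissible_add[OF sc a(1) b(1) S]])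
  also have "\<dots> = ennreal a + ennreal b"
    using a(1) b(1) by (intro ennreal_plus) (simp_all add: Rbound_admissible_def)
  also have "\<dots> \<le> (Rbound sc A + ennreal (e / 2)) + (Rbound sc B + ennreal (e / 2))"
    using a(2) b(2) by (intro add_mono less_imp_le)
  also have "\<dots> = Rbound sc A + Rbound sc B + (ennreal (e / 2) + ennreal (e / 2))"
    by (simp only: ac_simps)
  also have "ennreal (e / 2) + ennreal (e / 2) = ennreal e"
    using e by (simp flip: ennreal_plus)
  finally show "Rbound sc S \<le> Rbound sc A + Rbound sc B + ennreal e" .
qed

subsection \<open>Localization of the maximal function\<close>

lemma ennreal_powr_mono: "0 \<le> p \<Longrightarrow> x \<le> y \<Longrightarrow> ennreal_powr x p \<le> ennreal_powr y p"
  by (auto simp: ennreal_powr_def top_unique intro!: ennreal_leI powr_mono2 enn2real_mono simp flip: less_top)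

text \<open>
  The library integral of a non-measurable function is its lower integral, so that no measurability
  of \<open>u\<close> is needed here; Hoelder's inequality is replaced by \<open>t \<le> B + B\<^sup>1\<^sup>-\<^sup>p t\<^sup>p\<close>.
\<close>

lemma nn_integral_le_nn_integral_powr:
  fixes u :: "'b \<Rightarrow> ennreal"
  assumes Q: "Q \<in> sets M" and B: "0 < B" and p: "1 < p"
  shows "(\<integral>\<^sup>+x\<in>Q. u x \<partial>M) \<le>
    ennreal B * emeasure M Q + ennreal (B powr (1 - p)) * (\<integral>\<^sup>+x. ennreal_powr (u x) p \<partial>M)"
  unfolding nn_integral_def[of M "\<lambda>x. u x * indicator Q x"]
proof (rule SUP_least, clarify)
  fix g assume g: "simple_function M g" "g \<le> (\<lambda>x. u x * indicator Q x)"
  have "(\<lambda>x. ennreal_powr (g x) p) \<in> borel_measurable M"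
    using simple_function_compose1[OF g(1), of "\<lambda>y. ennreal_powr y p"]
    by (rule borel_measurable_simple_function)
  note [measurable] = this Q
  have le: "g x \<le> ennreal B * indicator Q x + ennreal (B powr (1 - p)) * ennreal_powr (g x) p" for x
  proof (cases "x \<in> Q")
    case False
    moreover have "g x \<le> u x * indicator Q x"
      using g(2) by (simp add: le_fun_def)
    ultimately show ?thesis by simp
  next
    case True
    show ?thesis
    proof (cases "g x")
      case (real r)
      show ?thesis
      proof (cases "r \<le> B")
        case True
        then have "g x \<le> ennreal B * indicator Q x"
          using real \<open>x \<in> Q\<close> by (simp add: ennreal_leI)
        then show ?thesis by (rule order_trans) simp
      next
        case False
        \<comment> \<open>Above the height \<open>B\<close> this factor is at least 1, and
          multiplying \<open>r\<close> by it produces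
          \<open>B powr (1 - p) * r powr p\<close>.\<close>
        have "1 \<le> (r / B) powr (p - 1)"
          using False B p by (intro ge_one_powr_ge_zero) auto
        then have "r * 1 \<le> r * (r / B) powr (p - 1)"
          using real by (intro mult_left_mono) auto
        also have "\<dots> = B powr (1 - p) * r powr p"
          using False B by (simp add: powr_divide powr_diff field_simps)
        finally have "g x \<le> ennreal (B powr (1 - p)) * ennreal_powr (g x) p"
          using real by (simp add: ennreal_powr_def ennreal_leI flip: ennreal_mult)
        then show ?thesis by (rule order_trans) simp
      qed
    next
      case top
      then show ?thesis using B by (simp add: ennreal_powr_def ennreal_mult_top)
    qed
  qed
  have "integral\<^sup>S M g = (\<integral>\<^sup>+x. g x \<partial>M)"
    using g(1) by (rule nn_integral_eq_simple_integral[symmetric])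
  also have "\<dots> \<le> (\<integral>\<^sup>+x. ennreal B * indicator Q x + ennreal (B powr (1 - p)) * ennreal_powr (g x) p \<partial>M)"
    by (intro nn_integral_mono le)
  also have "\<dots> = ennreal B * emeasure M Q + ennreal (B powr (1 - p)) * (\<integral>\<^sup>+x. ennreal_powr (g x) p \<partial>M)"
    by (simp add: nn_integral_add nn_integral_cmult nn_integral_cmult_indicator)
  also have "\<dots> \<le> ennreal B * emeasure M Q + ennreal (B powr (1 - p)) * (\<integral>\<^sup>+x. ennreal_powr (u x) p \<partial>M)"
  proof (intro add_left_mono mult_left_mono nn_integral_mono)
    fix x
    have "g x \<le> u x * indicator Q x"
      using g(2) by (simp add: le_fun_def)
    also have "\<dots> \<le> u x"
      by (auto simp: indicator_def)
    finally show "ennreal_powr (g x) p \<le> ennreal_powr (u x) p"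
      using p by (intro ennreal_powr_mono) auto
  qed auto
  finally show "integral\<^sup>S M g \<le>
    ennreal B * emeasure M Q + ennreal (B powr (1 - p)) * (\<integral>\<^sup>+x. ennreal_powr (u x) p \<partial>M)" .
qed

lemma divide_le_iff_ennreal:
  fixes a y z :: ennreal
  assumes "0 < y" "y < top"
  shows "a / y \<le> z \<longleftrightarrow> a \<le> z * y"
proof
  assume "a / y \<le> z"
  then have "a / y * y \<le> z * y" by (rule mult_right_mono) simp
  then show "a \<le> z * y"
    using assms by (simp add: ennreal_divide_times ennreal_divide_self)
next
  assume "a \<le> z * y"
  then have "a / y \<le> z * y / y" by (rule divide_right_mono_ennreal)
  then show "a / y \<le> z"
    using assms by (simp add: ennreal_mult_divide_eq)
qed

text \<open>For finite \<open>z\<close> all quantities are real and the absolute value opens with a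
  known sign; for infinite \<open>z\<close> the bound is trivial. It links one-sided bounds in
  \<open>ennreal\<close> to the \<open>ereal\<close> form of the scalar seminorm.\<close>

lemma e2ennreal_abs_diff_le:
  assumes "ennreal c \<le> y" "y \<le> ennreal c + z" "0 \<le> c"
  shows "e2ennreal \<bar>enn2ereal y - ereal c\<bar> \<le> z"
proof (cases z)
  case (real t)
  with assms have "y < top"
    by (metis ennreal_less_top ennreal_plus le_less_trans)
  then obtain r where r: "y = ennreal r" "0 \<le> r"
    by (cases y) auto
  with assms real have "c \<le> r" "r \<le> c + t"
    by (simp_all flip: ennreal_plus)
  then show ?thesis
    using r real by (simp add: enn2ereal_ennreal e2ennreal_ereal ennreal_leI)
qed simp

section \<open>Comparison of the maximal function with a constant on a cube\<close>

context dyadic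
begin

lemma average_indicator_diff:
  fixes f :: "real^'n \<Rightarrow> 'a::banach"
  assumes f: "locally_bochner_integrable f" and R: "R \<in> D j" and RQ: "R \<subseteq> Q"
  shows "average (\<lambda>x. indicator Q x *\<^sub>R (f x - v)) R = average f R - v"
proof -
  have "(\<lambda>x. indicator R x *\<^sub>R (indicator Q x *\<^sub>R (f x - v))) = (\<lambda>x. indicator R x *\<^sub>R (f x - v))"
    using RQ by (intro ext) (auto split: split_indicator)
  then show ?thesis
    using bochner_int_eq[OF has_bochner_average_diff[OF f R, of v]] measure_D_pos[OF R]
    by (simp add: average_def)
qed

text \<open>Averages over cubes containing \<open>Q\<close> contribute the same constant at every point of \<open>Q\<close>.\<close>

lemma rademacher_maximal_localize:
  fixes f :: "real^'n \<Rightarrow> 'a::banach"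
  assumes sc: "banach_scaling sc" and f: "locally_bochner_integrable f" and Q: "Q \<in> D k" and x: "x \<in> Q"
  defines "c \<equiv> Rbound sc {average f R | R. R \<in> (\<Union>j. D j) \<and> Q \<subseteq> R}"
  shows "c \<le> rademacher_maximal sc D f x"
    and "rademacher_maximal sc D f x
      \<le> c + rademacher_maximal sc D (\<lambda>y. indicator Q y *\<^sub>R (f y - average f Q)) x"
proof -
  show "c \<le> rademacher_maximal sc D f x"
    unfolding c_def rademacher_maximal_def using x by (intro Rbound_mono) blast
  let ?h = "\<lambda>y. indicator Q y *\<^sub>R (f y - average f Q)"
  show "rademacher_maximal sc D f x \<le> c + rademacher_maximal sc D ?h x"
    unfolding c_def rademacher_maximal_def
  proof (rule Rbound_add_le[OF sc])
    fix z assume "z \<in> {average f R | R. R \<in> (\<Union>j. D j) \<and> x \<in> R}"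
    then obtain R j where R: "z = average f R" "R \<in> D j" "x \<in> R"
      by blast
    show "\<exists>a\<in>{average f R | R. R \<in> (\<Union>j. D j) \<and> Q \<subseteq> R}.
      \<exists>b\<in>{average ?h R | R. R \<in> (\<Union>j. D j) \<and> x \<in> R}. z = a + b"
    proof (cases "j \<le> k")
      case True
      then have QR: "Q \<subseteq> R"
        using cube_antimono[of j k x] cube_eq[OF Q x] cube_eq[OF R(2,3)] by simp
      \<comment> \<open>For a large cube \<open>R\<close> the second summand is 0, which belongs to
        the second set as the average of \<open>?h\<close> over \<open>Q\<close>.\<close>
      have "average ?h Q = 0"
        using average_indicator_diff[OF f Q subset_refl, of "average f Q"] by simp
      then have "z = average f R + average ?h Q"
        using R by simp
      then show ?thesis
        using R(2) Q QR x by blast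
    next
      case False
      then have "R \<subseteq> Q"
        using cube_antimono[of k j x] cube_eq[OF Q x] cube_eq[OF R(2,3)] by simp
      then have "average ?h R = average f R - average f Q"
        by (rule average_indicator_diff[OF f R(2)])
      \<comment> \<open>For a small cube the first summand is the average over \<open>Q\<close>
        itself, which belongs to the first set since \<open>Q\<close> contains
        \<open>Q\<close>.\<close>
      then have "z = average f Q + average ?h R"
        using R by simp
      then show ?thesis
        using R(2,3) Q by blast
    qed
  qed
qed

lemma nn_integral_norm_indicator_powr:
  fixes f :: "real^'n \<Rightarrow> 'a::banach"
  shows "(\<integral>\<^sup>+x. ennreal (norm (indicator Q x *\<^sub>R (f x - v)) powr p) \<partial>lebesgue)
    = (\<integral>\<^sup>+x\<in>Q. ennreal (norm (f x - v) powr p) \<partial>lebesgue)"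
  by (intro nn_integral_cong) (auto split: split_indicator)

text \<open>The splitting height in \<open>nn_integral_le_nn_integral_powr\<close> is chosen to be
  \<open>B\<close>. Its factor \<open>B powr (1 - p)\<close> meets the \<open>B powr p\<close> from
  the John--Nirenberg inequality, and the bound becomes linear in \<open>B\<close>.\<close>

lemma scalar_bmo_norm_le:
  fixes f :: "real^'n \<Rightarrow> 'a::banach" and sc :: "'k::real_normed_field \<Rightarrow> 'a \<Rightarrow> 'a"
  assumes sc: "banach_scaling sc" and p: "1 < p"
    and bound: "\<And>f :: real^'n \<Rightarrow> 'a. in_Lp p f \<Longrightarrow>
           (\<integral>\<^sup>+x. ennreal_powr (rademacher_maximal sc D f x) p \<partial>lebesgue)
           \<le> ennreal Cp * (\<integral>\<^sup>+x. ennreal (norm (f x) powr p) \<partial>lebesgue)"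
    and Cp: "0 \<le> Cp"
    and f: "locally_bochner_integrable f"
    and fin: "AE x in lebesgue. rademacher_maximal sc D f x < \<infinity>"
    and B: "0 < B" and osc: "oscillation_bounded f B"
  shows "scalar_bmo_norm D (\<lambda>x. enn2ereal (rademacher_maximal sc D f x))
    \<le> ennreal ((1 + Cp * john_nirenberg_const p) * B)"
  unfolding scalar_bmo_norm_def
proof (rule SUP_least)
  fix Q assume "Q \<in> (\<Union>k. D k)"
  then obtain k where Q: "Q \<in> D k" by blast
  define h where "h x = indicator Q x *\<^sub>R (f x - average f Q)" for x
  define K where "K = john_nirenberg_const p"
  define c where "c = Rbound sc {average f R | R. R \<in> (\<Union>j. D j) \<and> Q \<subseteq> R}"
  let ?M = "rademacher_maximal sc D"
  have K: "0 \<le> K"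
    unfolding K_def by (rule john_nirenberg_const_nonneg)
  have posQ: "0 < emeasure lebesgue Q" "emeasure lebesgue Q < top"
    by (simp_all add: emeasure_D[OF Q])
  note loc = rademacher_maximal_localize[OF sc f Q, folded h_def c_def]
  \<comment> \<open>A cube has positive measure, so almost everywhere finiteness yields a point in
    it; at that point the maximal function dominates \<open>c\<close>, which is therefore
    finite.\<close>
  have "\<exists>x\<in>Q. ?M f x < \<infinity>"
  proof (rule ccontr)
    assume none: "\<not> (\<exists>x\<in>Q. ?M f x < \<infinity>)"
    from fin have "AE x in lebesgue. x \<notin> Q"
      by eventually_elim (use none in blast)
    then have "emeasure lebesgue Q = 0"
      using AE_iff_null_sets[OF sets_D[OF Q]] by auto
    with posQ show False by simp
  qed
  then have "c < top"
    using loc(1) le_less_trans by fastforce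
  then obtain c' where c': "c = ennreal c'" "0 \<le> c'"
    by (cases c) auto
  have h_powr: "(\<integral>\<^sup>+x. ennreal (norm (h x) powr p) \<partial>lebesgue) \<le> ennreal (K * B powr p) * emeasure lebesgue Q"
    unfolding h_def nn_integral_norm_indicator_powr K_def
    using p by (intro john_nirenberg[OF f B osc Q]) simp
  have "(\<integral>\<^sup>+x. ennreal (norm (h x) powr p) \<partial>lebesgue) < \<infinity>"
    by (rule le_less_trans[OF h_powr]) (simp add: emeasure_D[OF Q] ennreal_mult_less_top)
  moreover have "strongly_measurable lebesgue h"
    unfolding h_def[abs_def]
    by (rule has_bochner_imp_strongly_measurable[OF has_bochner_average_diff[OF f Q]])
  ultimately have Lp: "in_Lp p h"
    by (simp add: in_Lp_def)
  have "(\<integral>\<^sup>+x\<in>Q. e2ennreal \<bar>enn2ereal (?M f x) - ereal c'\<bar> \<partial>lebesgue) \<le> (\<integral>\<^sup>+x\<in>Q. ?M h x \<partial>lebesgue)"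
  proof (rule nn_integral_mono)
    fix x
    show "e2ennreal \<bar>enn2ereal (?M f x) - ereal c'\<bar> * indicator Q x \<le> ?M h x * indicator Q x"
    proof (cases "x \<in> Q")
      case True
      have "e2ennreal \<bar>enn2ereal (?M f x) - ereal c'\<bar> \<le> ?M h x"
        using loc[OF True] c' by (intro e2ennreal_abs_diff_le) (simp_all add: h_def[abs_def])
      then show ?thesis by (rule mult_right_mono) simp
    qed simp
  qed
  also have "\<dots> \<le> ennreal B * emeasure lebesgue Q
      + ennreal (B powr (1 - p)) * (\<integral>\<^sup>+x. ennreal_powr (?M h x) p \<partial>lebesgue)"
    by (rule nn_integral_le_nn_integral_powr[OF sets_D[OF Q] B p])
  also have "\<dots> \<le> ennreal B * emeasure lebesgue Q
      + ennreal (B powr (1 - p)) * (ennreal Cp * (ennreal (K * B powr p) * emeasure lebesgue Q))"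
    by (intro add_left_mono mult_left_mono order_trans[OF bound[OF Lp]] h_powr) auto
  also have "\<dots> = ennreal ((1 + Cp * K) * B) * emeasure lebesgue Q"
  proof -
    have "B powr (1 - p) * B powr p = B"
      using B by (simp flip: powr_add)
    then have "B + B powr (1 - p) * (Cp * (K * B powr p)) = (1 + Cp * K) * B"
      by (metis (no_types, opaque_lifting) distrib_right mult.assoc mult.commute mult_1)
    then show ?thesis
      using B Cp K by (simp add: distrib_right[symmetric] mult.assoc[symmetric] flip: ennreal_mult ennreal_plus)
  qed
  finally have "(\<integral>\<^sup>+x\<in>Q. e2ennreal \<bar>enn2ereal (?M f x) - ereal c'\<bar> \<partial>lebesgue) / emeasure lebesgue Q
      \<le> ennreal ((1 + Cp * K) * B)"
    using divide_le_iff_ennreal[OF posQ] by blast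
  then show "(INF c. (\<integral>\<^sup>+x\<in>Q. e2ennreal \<bar>enn2ereal (?M f x) - ereal c\<bar> \<partial>lebesgue) / emeasure lebesgue Q)
      \<le> ennreal ((1 + Cp * john_nirenberg_const p) * B)"
    unfolding K_def by (rule INF_lower2[OF UNIV_I])
qed

section \<open>From oscillation bounds to the BMO norm\<close>

lemma oscillation_bounded_of_bmo_norm:
  assumes "bmo_norm D f \<le> ennreal B"
  shows "oscillation_bounded f B"
  unfolding oscillation_bounded_def
proof (intro allI ballI)
  fix k Q assume Q: "Q \<in> D k"
  have "(\<integral>\<^sup>+x\<in>Q. ennreal (norm (f x - average f Q)) \<partial>lebesgue) / emeasure lebesgue Q \<le> bmo_norm D f"
    unfolding bmo_norm_def using Q by (intro SUP_upper) blast
  also note assms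
  finally show "(\<integral>\<^sup>+x\<in>Q. ennreal (norm (f x - average f Q)) \<partial>lebesgue) \<le> ennreal B * emeasure lebesgue Q"
    by (subst (asm) divide_le_iff_ennreal) (simp_all add: emeasure_D[OF Q])
qed

end

theorem theorem2:
  fixes sc :: "'k::real_normed_field \<Rightarrow> 'a::banach \<Rightarrow> 'a"
    and D :: "int \<Rightarrow> (real^'n) set set"
    and p Cp :: real
  assumes "banach_scaling sc"
    and "dyadic_system D"
    and "1 < p"
    and "\<And>f :: real^'n \<Rightarrow> 'a. in_Lp p f \<Longrightarrow>
           (\<integral>\<^sup>+x. ennreal_powr (rademacher_maximal sc D f x) p \<partial>lebesgue)
           \<le> ennreal Cp * (\<integral>\<^sup>+x. ennreal (norm (f x) powr p) \<partial>lebesgue)"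
  shows "\<exists>C\<ge>0. \<forall>f :: real^'n \<Rightarrow> 'a.
           locally_bochner_integrable f \<and>
           (AE x in lebesgue. rademacher_maximal sc D f x < \<infinity>) \<longrightarrow>
           scalar_bmo_norm D (\<lambda>x. enn2ereal (rademacher_maximal sc D f x))
           \<le> ennreal C * bmo_norm D f"
proof -
  interpret dyadic D
    by unfold_locales (rule assms(2))
  \<comment> \<open>\<open>Cp\<close> may be negative, where \<open>ennreal Cp\<close> is 0; the
    maximum gives a nonnegative constant for which the assumed bound still holds.\<close>
  define C where "C = 1 + max 0 Cp * john_nirenberg_const p"
  have C: "0 < C"
    unfolding C_def using john_nirenberg_const_nonneg[of p] by (intro add_pos_nonneg mult_nonneg_nonneg) auto
  have bound: "(\<integral>\<^sup>+x. ennreal_powr (rademacher_maximal sc D f x) p \<partial>lebesgue)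
      \<le> ennreal (max 0 Cp) * (\<integral>\<^sup>+x. ennreal (norm (f x) powr p) \<partial>lebesgue)"
    if "in_Lp p f" for f :: "real^'n \<Rightarrow> 'a"
    using assms(4)[OF that] by (rule order_trans) (intro mult_right_mono ennreal_leI; simp)
  show ?thesis
  proof (intro exI[of _ C] conjI allI impI)
    fix f :: "real^'n \<Rightarrow> 'a"
    assume "locally_bochner_integrable f \<and> (AE x in lebesgue. rademacher_maximal sc D f x < \<infinity>)"
    then have f: "locally_bochner_integrable f"
      and fin: "AE x in lebesgue. rademacher_maximal sc D f x < \<infinity>"
      by auto
    show "scalar_bmo_norm D (\<lambda>x. enn2ereal (rademacher_maximal sc D f x)) \<le> ennreal C * bmo_norm D f"
    proof (cases "bmo_norm D f")
      case (real b)
      show ?thesis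
      proof (rule ennreal_le_epsilon)
        fix e :: real assume e: "0 < e"
        \<comment> \<open>The estimate requires a positive oscillation bound, while \<open>b\<close>
          may be 0. The surplus \<open>e / C\<close> costs exactly \<open>e\<close> after
          multiplication by \<open>C\<close>.\<close>
        have B: "0 < b + e / C"
          using real C e by (intro add_nonneg_pos) auto
        have "bmo_norm D f \<le> ennreal (b + e / C)"
          unfolding real using C e by (intro ennreal_leI) simp
        from scalar_bmo_norm_le[OF assms(1,3) bound _ f fin B oscillation_bounded_of_bmo_norm[OF this]]
        have "scalar_bmo_norm D (\<lambda>x. enn2ereal (rademacher_maximal sc D f x)) \<le> ennreal (C * (b + e / C))"
          by (simp add: C_def)
        also have "C * (b + e / C) = C * b + e"
          using C by (simp add: field_simps)
        also have "ennreal (C * b + e) = ennreal C * bmo_norm D f + ennreal e"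
          using C e real by (simp add: ennreal_mult)
        finally show "scalar_bmo_norm D (\<lambda>x. enn2ereal (rademacher_maximal sc D f x))
            \<le> ennreal C * bmo_norm D f + ennreal e" .
      qed
    next
      case top
      \<comment> \<open>Since \<open>C\<close> is positive, the right-hand side is infinite.\<close>
      then show ?thesis using C by (simp add: ennreal_mult_top)
    qed
  qed (use C in simp)
qed

end
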